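(* Let $G$ be a finite group of odd order. Then the number of conjugacy classes of $G$ consisting of elements of prime power order equals the number of $\mathbb{Q}_{pp}$-valued irreducible (complex) characters of $G$.
   Context: All groups are finite and characters are ordinary complex characters. For a prime $p$, $\mathbb{Q}_p$ denotes (not the $p$-adic numbers but) the subfield of $\mathbb{C}$ obtained by adjoining to $\mathbb{Q}$ all $p^a$-th roots of unity for all positive integers $a$. A character $\chi$ of $G$ is called $\mathbb{Q}_{pp}$-valued if there exists a prime $p$ (depending on $\chi$) such that $\chi(g) \in \mathbb{Q}_p$ for all $g \in G$. An element has prime power order if its order is $p^a$ for some prime $p$ and integer $a \ge 0$; in particular the class of the identity is counted (and so is the principal character $1_G$ among the $\mathbb{Q}_{pp}$-valued characters). *)

theory Defs
  imports
    "HOL-Algebra.Group_Action"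
    "HOL-Algebra.Generated_Fields"
    "HOL-Computational_Algebra.Primes"
    "Jordan_Normal_Form.VS_Connect"
begin

definition conj_classes :: "('a, 'b) monoid_scheme \<Rightarrow> 'a set set" where
  "conj_classes G =
     orbits G (carrier G) (\<lambda>g. \<lambda>h\<in>carrier G. g \<otimes>\<^bsub>G\<^esub> h \<otimes>\<^bsub>G\<^esub> inv\<^bsub>G\<^esub> g)"

definition prime_power_order :: "('a, 'b) monoid_scheme \<Rightarrow> 'a \<Rightarrow> bool" where
  "prime_power_order G x \<longleftrightarrow> (\<exists>(p::nat) a. Factorial_Ring.prime p \<and> group.ord G x = p ^ a)"

(* The units of ring_mat TYPE(complex) n () form GL_n(C). *)
definition representation ::
    "('a, 'b) monoid_scheme \<Rightarrow> nat \<Rightarrow> ('a \<Rightarrow> complex mat) \<Rightarrow> bool" where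
  "representation G n \<rho> \<longleftrightarrow> \<rho> \<in> hom G (units_of (ring_mat TYPE(complex) n ()))"

definition invariant_subspace ::
    "('a, 'b) monoid_scheme \<Rightarrow> nat \<Rightarrow> ('a \<Rightarrow> complex mat) \<Rightarrow> complex vec set \<Rightarrow> bool" where
  "invariant_subspace G n \<rho> W \<longleftrightarrow>
     VectorSpace.subspace class_ring W (module_vec TYPE(complex) n) \<and>
     (\<forall>g\<in>carrier G. \<forall>w\<in>W. \<rho> g *\<^sub>v w \<in> W)"

definition irreducible_representation ::
    "('a, 'b) monoid_scheme \<Rightarrow> nat \<Rightarrow> ('a \<Rightarrow> complex mat) \<Rightarrow> bool" where
  "irreducible_representation G n \<rho> \<longleftrightarrow>
     representation G n \<rho> \<and> n > 0 \<and>
     (\<forall>W. invariant_subspace G n \<rho> W \<longrightarrow> W = {0\<^sub>v n} \<or> W = carrier_vec n)"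

definition mat_trace :: "'a::comm_monoid_add mat \<Rightarrow> 'a" where
  "mat_trace A = (\<Sum>i<dim_row A. A $$ (i, i))"

(* Characters are restricted to carrier G (and are undefined outside it), so that
   equality of characters, and hence counting them, only sees their values on the group. *)
definition afforded_character ::
    "('a, 'b) monoid_scheme \<Rightarrow> ('a \<Rightarrow> complex mat) \<Rightarrow> 'a \<Rightarrow> complex" where
  "afforded_character G \<rho> = (\<lambda>g\<in>carrier G. mat_trace (\<rho> g))"

definition irreducible_characters :: "('a, 'b) monoid_scheme \<Rightarrow> ('a \<Rightarrow> complex) set" where
  "irreducible_characters G =
     {afforded_character G \<rho> | n \<rho>. irreducible_representation G n \<rho>}"

(* The subfield of the complex numbers generated by the rationals and all roots of
   unity of p-power order; not the p-adic numbers. *)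
definition Q_field :: "nat \<Rightarrow> complex set" where
  "Q_field p = generate_field class_ring (\<rat> \<union> {z. \<exists>a>0. z ^ (p ^ a) = 1})"

definition Qpp_valued :: "('a, 'b) monoid_scheme \<Rightarrow> ('a \<Rightarrow> complex) \<Rightarrow> bool" where
  "Qpp_valued G \<chi> \<longleftrightarrow> (\<exists>p. Factorial_Ring.prime p \<and> (\<forall>g\<in>carrier G. \<chi> g \<in> Q_field p))"

end

theory Submission
  imports
    Defs
    "Jordan_Normal_Form.Schur_Decomposition"
    "Jordan_Normal_Form.DL_Rank"
    "HOL-Number_Theory.Residues"
    "HOL-Computational_Algebra.Field_as_Ring"
    "HOL-Computational_Algebra.Fundamental_Theorem_Algebra"
begin

text \<open>
  Let \<open>n\<close> be the order of \<open>G\<close> and, for a prime \<open>p\<close>, write \<open>n = p ^ c * n'\<close> with \<open>n'\<close> prime to \<open>p\<close>. Let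
  \<open>\<kappa>\<close> be an exponent that is congruent to \<open>1\<close> modulo \<open>p ^ c\<close> and to \<open>-1\<close> modulo \<open>n'\<close>. The map
  \<open>g \<mapsto> g ^ \<kappa>\<close> is an involution of \<open>G\<close>, and \<open>\<chi> \<mapsto> \<chi>(g ^ \<kappa>)\<close> is the action on characters of the Galois
  automorphism that fixes the \<open>p\<close>-power roots of unity and conjugates the roots of unity of order
  prime to \<open>p\<close>. Everything follows from comparing what this single involution fixes on the two sides.

  On classes: if \<open>g\<close> is conjugate to \<open>g ^ \<kappa>\<close>, then the \<open>p'\<close>-part of \<open>g\<close> is conjugate to its inverse; in
  a group of odd order only the identity has this property. So the classes fixed by \<open>\<kappa>\<close> are exactly the
  classes of \<open>p\<close>-elements (\<open>conjugate_\<kappa>_power\<close>). Column orthogonality gives the permutation lemma of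
  Brauer in the form needed here: a power map fixes as many irreducible characters as classes
  (\<open>card_fixed_characters\<close>).

  On characters: a \<open>Q_field p\<close>-valued character is fixed by \<open>\<kappa>\<close>, because a rational relation among roots
  of unity survives raising them to a coprime power (\<open>rational_relation_coprime_power\<close>). The converse
  is the heart of the proof and is a parity argument
  (\<open>characters_determined_by_fixed_elements\<close>). Suppose that \<open>\<chi>\<close> and \<open>\<psi>\<close> are distinct, fixed by \<open>\<kappa>\<close>, and
  agree on all \<open>p\<close>-elements. Then \<open>n = \<Sum>g. \<chi>(g) (\<chi> - \<psi>)(inv g)\<close> is a sum over the elements moved by \<open>\<kappa>\<close>,
  which come in pairs with equal summands; so \<open>n\<close> is twice a cyclotomic integer, contradicting that \<open>n\<close>
  is odd. Now let \<open>\<chi>\<close> be fixed by \<open>\<kappa>\<close>, and let \<open>\<sigma>\<close> be any Galois automorphism that fixes the \<open>p\<close>-power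
  roots of unity. The conjugate of \<open>\<chi>\<close> by \<open>\<sigma>\<close> is again irreducible, is fixed by \<open>\<kappa>\<close> since the Galois group
  is abelian, and agrees with \<open>\<chi>\<close> on \<open>p\<close>-elements; hence it equals \<open>\<chi>\<close>. Averaging over all such \<open>\<sigma>\<close>
  expresses the values of \<open>\<chi>\<close> through \<open>p\<close>-power roots of unity and Ramanujan sums, which are rational.

  Thus for every prime \<open>p\<close> there are as many \<open>Q_field p\<close>-valued irreducible characters as classes of
  \<open>p\<close>-elements (\<open>card_Q_field_valued\<close>). For two different primes the sets of classes share only the class
  of the identity, and the sets of characters share only the principal character: a common character is
  real, and the permutation lemma for \<open>g \<mapsto> inv g\<close> leaves room for one real character only.

  The character theory is built around the observation that irreducible characters are precisely the
  functions satisfying the multiplicativity formula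
  \<open>n \<chi>(g) \<chi>(h) = \<chi>(1) (\<Sum>t. \<chi>(g t h inv t))\<close>, a norm condition, and positivity of an integral degree
  (\<open>irreducible_characters_eq\<close>). These are polynomial identities with rational coefficients between
  character values, and this makes the set of irreducible characters visibly stable under Galois
  conjugation.
\<close>

section \<open>Cyclotomic integers\<close>

text \<open>
  The ring generated by the \<open>N\<close>-th roots of unity, described as their additive closure; closure under
  multiplication is then a consequence, as products of roots of unity are roots of unity.
\<close>

inductive_set cyclotomic_integers :: "nat \<Rightarrow> complex set" for N where
  zero: "0 \<in> cyclotomic_integers N"
| root: "z ^ N = 1 \<Longrightarrow> z \<in> cyclotomic_integers N"
| add: "x \<in> cyclotomic_integers N \<Longrightarrow> y \<in> cyclotomic_integers N \<Longrightarrow> x + y \<in> cyclotomic_integers N"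
| neg: "x \<in> cyclotomic_integers N \<Longrightarrow> - x \<in> cyclotomic_integers N"

lemma cyclotomic_integers_one: "1 \<in> cyclotomic_integers N"
  by (rule cyclotomic_integers.root) simp

lemma cyclotomic_integers_mult:
  assumes "x \<in> cyclotomic_integers N" "y \<in> cyclotomic_integers N"
  shows "x * y \<in> cyclotomic_integers N"
  using assms(1)
proof (induction)
  case zero
  then show ?case by (simp add: cyclotomic_integers.zero)
next
  case (root z)
  from assms(2) show ?case
  proof (induction)
    case zero
    then show ?case by (simp add: cyclotomic_integers.zero)
  next
    case (root w)
    then show ?case using \<open>z ^ N = 1\<close>
      by (intro cyclotomic_integers.root) (simp add: power_mult_distrib)
  qed (auto simp: algebra_simps intro: cyclotomic_integers.intros dest: cyclotomic_integers.neg)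
qed (auto simp: algebra_simps intro: cyclotomic_integers.intros dest: cyclotomic_integers.neg)

lemma cyclotomic_integers_sum:
  "(\<And>i. i \<in> I \<Longrightarrow> f i \<in> cyclotomic_integers N) \<Longrightarrow> sum f I \<in> cyclotomic_integers N"
  by (induction I rule: infinite_finite_induct) (auto intro: cyclotomic_integers.intros)

lemma cyclotomic_integers_diff:
  "x \<in> cyclotomic_integers N \<Longrightarrow> y \<in> cyclotomic_integers N \<Longrightarrow> x - y \<in> cyclotomic_integers N"
  using cyclotomic_integers.add cyclotomic_integers.neg by fastforce

lemma cyclotomic_integers_of_nat: "of_nat k \<in> cyclotomic_integers N"
  by (induction k) (auto intro: cyclotomic_integers.intros cyclotomic_integers_one)

lemma cyclotomic_integers_of_int: "of_int k \<in> cyclotomic_integers N"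
  by (cases k rule: int_cases) 
    (auto intro: cyclotomic_integers.neg cyclotomic_integers_of_nat simp del: of_nat_Suc)

lemma cyclotomic_integers_power: "x \<in> cyclotomic_integers N \<Longrightarrow> x ^ k \<in> cyclotomic_integers N"
  by (induction k) (auto intro: cyclotomic_integers_one cyclotomic_integers_mult)

lemma root_of_unity_power_form:
  fixes z :: complex
  assumes "N > 0" "z ^ N = 1"
  obtains j where "j < N" "z = cis (2 * pi / N) ^ j"
proof -
  have "z \<in> (\<lambda>k. cis (2 * pi * real k / real N)) ` {..<N}"
    using bij_betw_roots_unity[OF assms(1)] assms(2) by (auto simp: bij_betw_def)
  then show thesis using that by (auto simp: DeMoivre mult_ac)
qed

lemma cyclotomic_integers_basis:
  assumes N: "N > 0" and "z \<in> cyclotomic_integers N"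
  shows "\<exists>a::nat \<Rightarrow> int. z = (\<Sum>j<N. of_int (a j) * cis (2 * pi / N) ^ j)"
  using assms(2)
proof (induction)
  case zero
  show ?case by (rule exI[of _ "\<lambda>_. 0"]) simp
next
  case (root z)
  then obtain j where j: "j < N" "z = cis (2 * pi / N) ^ j"
    using root_of_unity_power_form[OF N] by blast
  show ?case
    by (rule exI[of _ "\<lambda>i. if i = j then 1 else 0"])
      (use j in \<open>simp add: if_distrib[of "\<lambda>x. x * _"] if_distrib[of of_int] cong: if_cong\<close>)
next
  case (add x y)
  then obtain a b where "x = (\<Sum>j<N. of_int (a j) * cis (2 * pi / N) ^ j)"
    "y = (\<Sum>j<N. of_int (b j) * cis (2 * pi / N) ^ j)" by blast
  then show ?case
    by (intro exI[of _ "\<lambda>j. a j + b j"]) (simp add: sum.distrib algebra_simps)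
next
  case (neg x)
  then obtain a where "x = (\<Sum>j<N. of_int (a j) * cis (2 * pi / N) ^ j)" by blast
  then show ?case
    by (intro exI[of _ "\<lambda>j. - a j"]) (simp add: sum_negf)
qed

text \<open>
  Multiplication by \<open>z\<close> maps each power of a fixed primitive root of unity to an integral combination
  of such powers. So \<open>z\<close> is an eigenvalue of an integer matrix, with the vector of powers as eigenvector, and a
  root of its monic integral characteristic polynomial.
\<close>

lemma cyclotomic_integer_algebraic:
  assumes N: "N > 0" and z: "z \<in> cyclotomic_integers N"
  shows "algebraic_int z"
proof -
  define w where "w = cis (2 * pi / N)"
  have wN: "w ^ N = 1" using N by (simp add: w_def DeMoivre)
  \<comment> \<open>The rows of the matrix; they are not unique, any choice will do.\<close>
  have "\<exists>a::nat \<Rightarrow> int. z * w ^ i = (\<Sum>j<N. of_int (a j) * w ^ j)" for i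
    unfolding w_def
    by (intro cyclotomic_integers_basis[OF N] cyclotomic_integers_mult[OF z] cyclotomic_integers_power
        cyclotomic_integers.root) (use wN w_def in simp)
  then obtain a :: "nat \<Rightarrow> nat \<Rightarrow> int" where a: "\<And>i. z * w ^ i = (\<Sum>j<N. of_int (a i j) * w ^ j)"
    by metis
  define A where "A = mat N N (\<lambda>(i, j). a i j)"
  have A: "A \<in> carrier_mat N N" by (simp add: A_def)
  define C where "C = map_mat (of_int :: int \<Rightarrow> complex) A"
  have C: "C \<in> carrier_mat N N" using A by (simp add: C_def)
  define v where "v = vec N (\<lambda>j. w ^ j)"
  have "C *\<^sub>v v = z \<cdot>\<^sub>v v"
    by (rule eq_vecI) (use A in \<open>auto simp: C_def v_def A_def scalar_prod_def a lessThan_atLeast0\<close>)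
  moreover have "v \<noteq> 0\<^sub>v N"
    using N by (metis index_vec index_zero_vec(1) power_0 v_def zero_neq_one)
  ultimately have "eigenvalue C z"
    unfolding eigenvalue_def eigenvector_def using C by (intro exI[of _ v]) (auto simp: v_def)
  then have "poly (char_poly C) z = 0"
    using eigenvalue_root_char_poly[OF C] by blast
  moreover have "char_poly C = map_poly of_int (char_poly A)"
    unfolding C_def by (rule of_int_hom.char_poly_hom[OF A])
  ultimately show ?thesis
    unfolding algebraic_int_altdef_ipoly using degree_monic_char_poly[OF A] by auto
qed

text \<open>
  This is how the parity argument, and every divisibility argument below, ends: a quotient of integers
  that is a cyclotomic integer is an integer.
\<close>

lemma cyclotomic_integer_rational:
  assumes "N > 0" "z \<in> cyclotomic_integers N" "z \<in> \<rat>"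
  shows "z \<in> \<int>"
  using assms cyclotomic_integer_algebraic rational_algebraic_int_is_int by blast

text \<open>
  Multiplying the summation variable by a primitive root permutes the roots of unity, so the sum is
  either zero or all its terms are \<open>1\<close>.
\<close>

lemma sum_roots_of_unity_power:
  fixes N m :: nat
  assumes N: "N > 0"
  shows "(\<Sum>\<omega> | \<omega> ^ N = 1. \<omega> ^ m :: complex) \<in> \<rat>"
proof -
  define w where "w = cis (2 * pi / N)"
  have wN: "w ^ N = 1" using N by (simp add: w_def DeMoivre)
  let ?S = "\<Sum>\<omega> | \<omega> ^ N = 1. \<omega> ^ m :: complex"
  have w0: "w \<noteq> 0" by (simp add: w_def)
  have "?S = (\<Sum>\<omega> | \<omega> ^ N = 1. (w * \<omega>) ^ m)"
    by (rule sum.reindex_bij_witness[of _ "\<lambda>\<omega>. w * \<omega>" "\<lambda>\<omega>. \<omega> / w"])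
      (use w0 wN in \<open>auto simp: power_mult_distrib power_divide\<close>)
  also have "\<dots> = w ^ m * ?S" by (simp add: power_mult_distrib sum_distrib_left)
  finally have eq: "?S = w ^ m * ?S" .
  show ?thesis
  proof (cases "w ^ m = 1")
    case False
    then have "?S = 0" using eq by simp
    then show ?thesis by simp
  next
    case True
    have "\<omega> ^ m = 1" if "\<omega> ^ N = 1" for \<omega> :: complex
    proof -
      obtain j where "\<omega> = w ^ j" using root_of_unity_power_form[OF N \<open>\<omega> ^ N = 1\<close>] w_def by blast
      then show ?thesis using True by (metis power_mult mult.commute power_one)
    qed
    then have "?S = of_nat (card {\<omega>::complex. \<omega> ^ N = 1})" by simp
    then show ?thesis by simp
  qed
qed

section \<open>Galois conjugation of roots of unity\<close>

abbreviation rpoly :: "rat poly \<Rightarrow> complex \<Rightarrow> complex" where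
  "rpoly P z \<equiv> poly (map_poly of_rat P) z"

lemma rpoly_simps:
  "rpoly (P + Q) z = rpoly P z + rpoly Q z"
  "rpoly (P * Q) z = rpoly P z * rpoly Q z"
  "rpoly (P - Q) z = rpoly P z - rpoly Q z"
  "rpoly (- P) z = - rpoly P z"
  "rpoly (smult c P) z = of_rat c * rpoly P z"
  "rpoly 1 z = 1" "rpoly 0 z = 0" "rpoly [:c:] z = of_rat c"
  "rpoly (monom c k) z = of_rat c * z ^ k"
proof -
  interpret map_poly_comm_ring_hom "of_rat :: rat \<Rightarrow> complex" ..
  show "rpoly (P + Q) z = rpoly P z + rpoly Q z" "rpoly (P * Q) z = rpoly P z * rpoly Q z"
    "rpoly (P - Q) z = rpoly P z - rpoly Q z" "rpoly (- P) z = - rpoly P z"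
    "rpoly (smult c P) z = of_rat c * rpoly P z"
    "rpoly 1 z = 1" "rpoly 0 z = 0" "rpoly [:c:] z = of_rat c"
    "rpoly (Polynomial.monom c k) z = of_rat c * z ^ k"
    by (simp_all add: hom_distribs poly_monom)
qed


text \<open>
  The algebra of rational polynomials modulo \<open>X ^ N - 1\<close> is a product of fields, because \<open>X ^ N - 1\<close> is
  separable. Hence \<open>P\<close> has an idempotent \<open>Q\<close> cutting out its zeros among the \<open>N\<close>-th roots of unity and an
  inverse \<open>R\<close> away from them.
\<close>

lemma rational_polynomial_quasi_inverse:
  fixes P :: "rat poly"
  assumes N: "N > 0"
  obtains Q R :: "rat poly" where
    "\<And>\<omega>. \<omega> ^ N = 1 \<Longrightarrow> rpoly Q \<omega> = (if rpoly P \<omega> = 0 then 1 else 0)"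
    "\<And>\<omega>. \<omega> ^ N = 1 \<Longrightarrow> rpoly P \<omega> \<noteq> 0 \<Longrightarrow> rpoly P \<omega> * rpoly R \<omega> = 1"
proof -
  define F :: "rat poly" where "F = Polynomial.monom 1 N - 1"
  define D where "D = gcd P F"
  obtain M where FM: "F = D * M" unfolding D_def by (metis dvdE gcd_dvd2)
  obtain C where PC: "P = D * C" unfolding D_def by (metis dvdE gcd_dvd1)
  obtain a b where ab: "a * P + b * F = D"
    unfolding D_def by (metis bezout_coefficients_fst_snd)
  define X :: "rat poly" where "X = Polynomial.monom 1 1"
  define N' :: "rat poly" where "N' = [:of_nat N:]"
  \<comment> \<open>Euler: the derivative of \<open>F\<close> and \<open>F\<close> generate the unit ideal. With \<open>F = D * M\<close> this splits into a Bezout identity for \<open>D\<close> and \<open>M\<close>.\<close>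
  have "X * pderiv F - N' * F = N'"
    using N by (simp add: X_def F_def N'_def pderiv_diff pderiv_monom mult_monom algebra_simps smult_monom)
  then have eq: "N' = M * (X * pderiv D) + D * (X * pderiv M - N' * M)"
    unfolding FM by (simp add: pderiv_mult algebra_simps)
  define Q where "Q = smult (1 / of_nat N) (M * (X * pderiv D))"
  define U where "U = smult (1 / of_nat N) (X * pderiv M - N' * M)"
  have "Q + D * U = smult (1 / of_nat N) N'"
    by (subst eq) (simp add: Q_def U_def smult_add_right)
  also have "\<dots> = 1" using N by (simp add: N'_def)
  finally have one: "Q + D * U = 1" .
  have *: "rpoly F \<omega> = 0" if "\<omega> ^ N = 1" for \<omega>
    using that by (simp add: F_def rpoly_simps poly_monom)
  have ab': "rpoly D \<omega> = rpoly a \<omega> * rpoly P \<omega>" if "\<omega> ^ N = 1" for \<omega>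
    unfolding ab[symmetric] by (simp add: rpoly_simps *[OF that])
  have QDU: "rpoly Q \<omega> + rpoly D \<omega> * rpoly U \<omega> = 1" for \<omega>
    using arg_cong[OF one, of "\<lambda>p. rpoly p \<omega>"] by (simp add: rpoly_simps)
  have MD: "rpoly D \<omega> * rpoly M \<omega> = 0" if "\<omega> ^ N = 1" for \<omega>
    using *[OF that] by (simp add: FM rpoly_simps)
  have P0: "rpoly P \<omega> = 0 \<longleftrightarrow> rpoly D \<omega> = 0" if "\<omega> ^ N = 1" for \<omega>
  proof -
    have "rpoly P \<omega> = rpoly D \<omega> * rpoly C \<omega>" unfolding PC by (simp add: rpoly_simps)
    then show ?thesis using ab'[OF that] by (metis mult_zero_left mult_zero_right)
  qed
  have Q0: "rpoly Q \<omega> = 0" if "rpoly M \<omega> = 0" for \<omega>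
    using that by (simp add: Q_def rpoly_simps)
  show thesis
  proof (rule that[of Q "a * U"])
    fix \<omega> :: complex assume w: "\<omega> ^ N = 1"
    show "rpoly Q \<omega> = (if rpoly P \<omega> = 0 then 1 else 0)"
    proof (cases "rpoly D \<omega> = 0")
      case True
      then show ?thesis using P0[OF w] QDU[of \<omega>] by simp
    next
      case False
      then show ?thesis using P0[OF w] MD[OF w] Q0[of \<omega>] by simp
    qed
    assume "rpoly P \<omega> \<noteq> 0"
    then have "rpoly D \<omega> \<noteq> 0" using P0[OF w] by simp
    then have "rpoly D \<omega> * rpoly U \<omega> = 1" using MD[OF w] Q0[of \<omega>] QDU[of \<omega>] by simp
    then show "rpoly P \<omega> * rpoly (a * U) \<omega> = 1" unfolding ab'[OF w] by (simp add: rpoly_simps mult_ac)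
  qed
qed

lemma sum_powers_root_of_unity:
  fixes x :: complex
  assumes "x ^ N = 1"
  shows "(\<Sum>j<N. x ^ j) = (if x = 1 then of_nat N else 0)"
  using assms by (simp add: geometric_sum)

lemma rpoly_as_sum: "rpoly P z = (\<Sum>i\<le>degree P. of_rat (coeff P i) * z ^ i)"
  by (simp add: poly_altdef)

text \<open>
  The coefficients are obtained from the idempotent above by Fourier inversion on the \<open>N\<close>-th roots of
  unity. They are rational as well as cyclotomic integers; the factor \<open>N\<close> in the values is the
  denominator that inversion would introduce.
\<close>

lemma integral_indicator_polynomial:
  fixes P :: "rat poly"
  assumes N: "N > 0"
  obtains c :: "nat \<Rightarrow> int" where
    "\<And>\<omega>. \<omega> ^ N = 1 \<Longrightarrow> (\<Sum>j<N. of_int (c j) * \<omega> ^ j) = (if rpoly P \<omega> = 0 then of_nat N else 0)"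
proof -
  obtain Q R where Q: "\<And>\<omega>. \<omega> ^ N = 1 \<Longrightarrow> rpoly Q \<omega> = (if rpoly P \<omega> = 0 then 1 else 0)"
    using rational_polynomial_quasi_inverse[OF N] by metis
  \<comment> \<open>The factor \<open>\<omega> ^ ((N - 1) * j)\<close> is \<open>\<omega> ^ (- j)\<close> without negative exponents.\<close>
  define c where "c j = (\<Sum>\<omega> | \<omega> ^ N = 1. rpoly Q \<omega> * \<omega> ^ ((N - 1) * j))" for j
  have "c j \<in> cyclotomic_integers N" for j
    unfolding c_def
    by (intro cyclotomic_integers_sum cyclotomic_integers_mult cyclotomic_integers_power)
      (auto simp: Q intro: cyclotomic_integers.intros)
  moreover have "c j \<in> \<rat>" for j
  proof -
    have "c j = (\<Sum>i\<le>degree Q. of_rat (coeff Q i) * (\<Sum>\<omega> | \<omega> ^ N = 1. \<omega> ^ (i + (N - 1) * j)))"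
      unfolding c_def rpoly_as_sum sum_distrib_left sum_distrib_right
      by (subst sum.swap) (simp add: power_add mult_ac)
    also have "\<dots> \<in> \<rat>"
      by (intro Rats_sum Rats_mult sum_roots_of_unity_power[OF N]) auto
    finally show ?thesis .
  qed
  ultimately have "c j \<in> \<int>" for j
    using cyclotomic_integer_rational[OF N] by blast
  then have "\<forall>j. \<exists>k. c j = of_int k" by (auto elim!: Ints_cases)
  then obtain k where k: "\<And>j. c j = of_int (k j)" by metis
  show thesis
  proof (rule that[of k])
    fix \<omega> :: complex assume w: "\<omega> ^ N = 1"
    have fin: "finite {\<eta>::complex. \<eta> ^ N = 1}" using N by (intro finite_roots_unity) auto
    have "(\<Sum>j<N. of_int (k j) * \<omega> ^ j) =
        (\<Sum>\<eta> | \<eta> ^ N = 1. rpoly Q \<eta> * (\<Sum>j<N. (\<eta> ^ (N - 1) * \<omega>) ^ j))"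
      unfolding k[symmetric] c_def sum_distrib_left sum_distrib_right
      by (subst sum.swap, simp only: power_mult_distrib power_mult, simp only: mult_ac)
    also have "\<dots> = (\<Sum>\<eta> | \<eta> ^ N = 1. if \<eta> = \<omega> then rpoly Q \<eta> * of_nat N else 0)"
    proof (rule sum.cong[OF refl])
      fix \<eta> :: complex assume "\<eta> \<in> {\<eta>. \<eta> ^ N = 1}"
      then have e: "\<eta> ^ N = 1" by simp
      have "\<eta> * \<eta> ^ (N - 1) = 1" using e N by (metis power_eq_if neq0_conv)
      then have iff: "\<eta> ^ (N - 1) * \<omega> = 1 \<longleftrightarrow> \<eta> = \<omega>"
        by (metis mult.assoc mult.commute mult.right_neutral)
      have "(\<eta> ^ (N - 1) * \<omega>) ^ N = 1"
        using e w by (metis power_mult_distrib power_mult mult.commute power_one mult_1)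
      from sum_powers_root_of_unity[OF this]
      show "rpoly Q \<eta> * (\<Sum>j<N. (\<eta> ^ (N - 1) * \<omega>) ^ j) = (if \<eta> = \<omega> then rpoly Q \<eta> * of_nat N else 0)"
        unfolding iff by simp
    qed
    also have "\<dots> = rpoly Q \<omega> * of_nat N" using fin w by simp
    finally show "(\<Sum>j<N. of_int (k j) * \<omega> ^ j) = (if rpoly P \<omega> = 0 then of_nat N else 0)"
      by (simp add: Q[OF w])
  qed
qed

lemma prime_dvd_int_power_minus:
  fixes c :: int
  assumes q: "Factorial_Ring.prime q"
  shows "int q dvd c ^ q - c"
proof -
  have q0: "q > 0" using q by (rule prime_gt_0_nat)
  define r where "r = nat (c mod int q)"
  have r: "[c = int r] (mod int q)" using q0 by (simp add: r_def cong_def)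
  have "[r ^ q = r] (mod q)"
  proof (cases "q dvd r")
    case True
    then have "q dvd r ^ q" using q0 by (meson dvd_power dvd_trans)
    with True show ?thesis by (simp add: cong_def)
  next
    case False
    then have "[r * r ^ (q - 1) = r * 1] (mod q)"
      by (intro cong_mult fermat_theorem q) auto
    moreover have "r * r ^ (q - 1) = r ^ q" using q0 by (cases q) auto
    ultimately show ?thesis by simp
  qed
  then have "[int r ^ q = int r] (mod int q)"
    by (simp flip: of_nat_power add: cong_int_iff)
  then have "[c ^ q = c] (mod int q)"
    using cong_trans[OF cong_pow[OF r]] cong_sym[OF r] cong_trans by blast
  then show ?thesis by (simp add: cong_iff_dvd_diff)
qed

text \<open>
  The Frobenius map modulo \<open>q\<close>, one summand at a time: inner binomial coefficients are divisible by \<open>q\<close>,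
  and integers are fixed by Fermat.
\<close>

lemma frobenius_congruence:
  assumes q: "Factorial_Ring.prime q" and "finite J"
    and "\<And>j. j \<in> J \<Longrightarrow> w j ^ N = 1"
  shows "\<exists>r\<in>cyclotomic_integers N.
    (\<Sum>j\<in>J. of_int (c j) * w j) ^ q = (\<Sum>j\<in>J. of_int (c j) * w j ^ q) + of_nat q * r"
  using assms(2,3)
proof (induction J)
  case empty
  then show ?case using prime_gt_0_nat[OF q] cyclotomic_integers.zero by force
next
  case (insert i J)
  let ?R = "cyclotomic_integers N"
  define x where "x = of_int (c i) * w i"
  define y where "y = (\<Sum>j\<in>J. of_int (c j) * w j)"
  define y' where "y' = (\<Sum>j\<in>J. of_int (c j) * w j ^ q)"
  obtain r where r: "r \<in> ?R" "y ^ q = y' + of_nat q * r"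
    using insert unfolding y_def y'_def by auto
  have xR: "x \<in> ?R" unfolding x_def
    using insert by (intro cyclotomic_integers_mult cyclotomic_integers_of_int cyclotomic_integers.root) auto
  have yR: "y \<in> ?R" unfolding y_def
    using insert by (intro cyclotomic_integers_sum cyclotomic_integers_mult cyclotomic_integers_of_int 
        cyclotomic_integers.root) auto
  obtain k where k: "c i ^ q = c i + int q * k"
    using prime_dvd_int_power_minus[OF q, of "c i"] by (metis add.commute diff_add_cancel dvdE)
  have q2: "q \<ge> 2" using q by (rule prime_ge_2_nat)
  define s where "s = (\<Sum>k\<in>{1..<q}. of_nat ((q choose k) div q) * x ^ k * y ^ (q - k))"
  have sR: "s \<in> ?R" unfolding s_def using xR yR
    by (intro cyclotomic_integers_sum cyclotomic_integers_mult cyclotomic_integers_of_nat cyclotomic_integers_power)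
  have "{..q} = insert 0 (insert q {1..<q})" using q2 by auto
  then have "(x + y) ^ q = y ^ q + x ^ q + (\<Sum>k\<in>{1..<q}. of_nat (q choose k) * x ^ k * y ^ (q - k))"
    using q2 by (subst binomial_ring) auto
  also have "(\<Sum>k\<in>{1..<q}. of_nat (q choose k) * x ^ k * y ^ (q - k)) = of_nat q * s"
    unfolding s_def sum_distrib_left
  proof (rule sum.cong[OF refl])
    fix k assume "k \<in> {1..<q}"
    then have "q dvd (q choose k)" using q by (intro dvd_choose_prime) auto
    then have "(q choose k) = q * ((q choose k) div q)" by simp
    then have "(of_nat (q choose k) :: complex) = of_nat q * of_nat ((q choose k) div q)"
      by (metis of_nat_mult)
    then show "of_nat (q choose k) * x ^ k * y ^ (q - k) =
      of_nat q * (of_nat ((q choose k) div q) * x ^ k * y ^ (q - k))" by simp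
  qed
  also have "x ^ q = of_int (c i) * w i ^ q + of_nat q * (of_int k * w i ^ q)"
  proof -
    have "x ^ q = of_int (c i ^ q) * w i ^ q" unfolding x_def by (simp add: power_mult_distrib)
    then show ?thesis unfolding k by (simp add: algebra_simps)
  qed
  finally have "(x + y) ^ q = (of_int (c i) * w i ^ q + y') + of_nat q * (r + of_int k * w i ^ q + s)"
    by (simp add: r(2) algebra_simps)
  moreover have "r + of_int k * w i ^ q + s \<in> ?R"
    by (intro cyclotomic_integers.add cyclotomic_integers_mult r(1) sR
        cyclotomic_integers_of_int cyclotomic_integers_power cyclotomic_integers.root[of "w i"] insert.prems) simp
  ultimately show ?case
    using insert.hyps unfolding x_def y_def y'_def by (intro bexI) auto
qed

text \<open>
  Let \<open>E\<close> be the integral polynomial taking the value \<open>N\<close> at the zeros of \<open>P\<close> among the \<open>N\<close>-th roots of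
  unity and \<open>0\<close> at the others. By the Frobenius congruence \<open>E(z ^ q)\<close> is congruent to \<open>E(z) ^ q = N ^ q\<close>
  modulo \<open>q\<close>. If \<open>z ^ q\<close> were not a zero of \<open>P\<close>, then \<open>q\<close> would divide \<open>N ^ q\<close>.
\<close>

lemma rational_relation_prime_power:
  assumes N: "N > 0" and z: "z ^ N = 1" and P: "rpoly P z = 0"
    and q: "Factorial_Ring.prime q" "\<not> q dvd N"
  shows "rpoly P (z ^ q) = 0"
proof (rule ccontr)
  assume nz: "rpoly P (z ^ q) \<noteq> 0"
  obtain c :: "nat \<Rightarrow> int" where c:
    "\<And>\<omega>. \<omega> ^ N = 1 \<Longrightarrow> (\<Sum>j<N. of_int (c j) * \<omega> ^ j) = (if rpoly P \<omega> = 0 then of_nat N else 0)"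
    using integral_indicator_polynomial[OF N] by blast
  have zq: "(z ^ q) ^ N = 1" using z by (metis power_mult mult.commute power_one)
  have "(z ^ j) ^ N = 1" for j using z by (metis power_mult mult.commute power_one)
  then obtain r where r: "r \<in> cyclotomic_integers N"
    "(\<Sum>j<N. of_int (c j) * z ^ j) ^ q = (\<Sum>j<N. of_int (c j) * (z ^ j) ^ q) + of_nat q * r"
    using frobenius_congruence[OF q(1), of "{..<N}" "\<lambda>j. z ^ j" N c] by auto
  have "(\<Sum>j<N. of_int (c j) * (z ^ j) ^ q) = (\<Sum>j<N. of_int (c j) * (z ^ q) ^ j)"
    by (simp add: power_mult[symmetric] mult.commute)
  with r c[OF z] c[OF zq] P nz have eq: "of_nat N ^ q = of_nat q * r" by simp
  have q0: "q > 0" using q(1) by (rule prime_gt_0_nat)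
  then have "r = of_nat N ^ q / of_nat q" using eq by simp
  then have "r \<in> \<rat>" by simp
  then obtain m where m: "r = of_int m"
    using cyclotomic_integer_rational[OF N r(1)] by (auto elim: Ints_cases)
  have "(of_int (int N ^ q) :: complex) = of_int (int q * m)" using eq m by simp
  then have "int N ^ q = int q * m" by (simp only: of_int_eq_iff)
  then have "int q dvd int N ^ q" by simp
  then have "q dvd N"
    by (metis int_dvd_int_iff of_nat_power prime_dvd_power q(1))
  with q(2) show False by simp
qed

text \<open>
  In place of automorphisms of cyclotomic fields: this says that \<open>z \<mapsto> z ^ k\<close> respects all rational
  relations; for primitive \<open>z\<close> it amounts to the irreducibility of cyclotomic polynomials. It follows from the prime
  case by multiplicativity in \<open>k\<close>.
\<close>

lemma rational_relation_coprime_power: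
  assumes N: "N > 0" and z: "z ^ N = 1" and P: "rpoly P z = 0" and k: "coprime k N"
  shows "rpoly P (z ^ k) = 0"
proof (cases "k = 0")
  case True
  then have "N = 1" using k by simp
  then show ?thesis using True z P by simp
next
  case False
  then have "k > 0" by simp
  then show ?thesis using k
  proof (induction k rule: prime_divisors_induct)
    case zero
    then show ?case by simp
  next
    case (unit k)
    then show ?case using P by simp
  next
    case (factor q k)
    have k: "k > 0" "coprime k N" and cq: "coprime q N" using factor.prems by auto
    have "(z ^ k) ^ N = 1" using z by (metis power_mult mult.commute power_one)
    moreover have "\<not> q dvd N" using factor.hyps cq
      by (metis coprime_absorb_left not_prime_unit)
    moreover have "rpoly P (z ^ k) = 0" using factor.IH k by blast
    ultimately have "rpoly P ((z ^ k) ^ q) = 0"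
      using rational_relation_prime_power[OF N] factor.hyps by blast
    then show ?case by (simp add: power_mult[symmetric] mult.commute)
  qed
qed

section \<open>The field generated by roots of unity of prime power order\<close>

lemma Q_field_one: "1 \<in> Q_field p"
  and Q_field_add: "x \<in> Q_field p \<Longrightarrow> y \<in> Q_field p \<Longrightarrow> x + y \<in> Q_field p"
  and Q_field_mult: "x \<in> Q_field p \<Longrightarrow> y \<in> Q_field p \<Longrightarrow> x * y \<in> Q_field p"
  and Q_field_rat: "r \<in> \<rat> \<Longrightarrow> r \<in> Q_field p"
  and Q_field_root: "z ^ (p ^ a) = 1 \<Longrightarrow> z \<in> Q_field p"
proof -
  let ?G = "generate_field class_ring (\<rat> \<union> {z. \<exists>a>0. z ^ (p ^ a) = 1}) :: complex set"
  show "1 \<in> Q_field p"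
    using generate_field.one[of "class_ring :: complex ring"] by (simp add: Q_field_def)
  show "x \<in> Q_field p \<Longrightarrow> y \<in> Q_field p \<Longrightarrow> x + y \<in> Q_field p"
    using generate_field.eng_add[of x "class_ring :: complex ring"] by (simp add: Q_field_def)
  show "x \<in> Q_field p \<Longrightarrow> y \<in> Q_field p \<Longrightarrow> x * y \<in> Q_field p"
    using generate_field.eng_mult[of x "class_ring :: complex ring"] by (simp add: Q_field_def)
  show "r \<in> \<rat> \<Longrightarrow> r \<in> Q_field p"
    unfolding Q_field_def by (rule generate_field.incl) simp
  assume "z ^ (p ^ a) = 1"
  then have "z ^ (p ^ Suc a) = 1" by (metis power_Suc2 power_mult power_one)
  then show "z \<in> Q_field p"
    unfolding Q_field_def by (intro generate_field.incl) blast
qed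

lemma Q_field_sum_list: "(\<And>x. x \<in> set xs \<Longrightarrow> f x \<in> Q_field p) \<Longrightarrow> sum_list (map f xs) \<in> Q_field p"
  by (induction xs) (auto intro: Q_field_add Q_field_rat)

abbreviation zeta :: "nat \<Rightarrow> complex" where
  "zeta N \<equiv> cis (2 * pi / N)"

lemma zeta_power_eq_1: "N > 0 \<Longrightarrow> zeta N ^ N = 1"
  by (simp add: DeMoivre)

lemma zeta_mult_power:
  assumes "M > 0" shows "zeta (N * M) ^ M = zeta N"
  using assms by (cases "N = 0") (auto simp: DeMoivre field_simps)

lemma rpoly_pcompose_monom: "rpoly (pcompose P (Polynomial.monom 1 k)) z = rpoly P (z ^ k)"
proof -
  interpret map_poly_comm_ring_hom "of_rat :: rat \<Rightarrow> complex" ..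
  show ?thesis
    by (simp add: of_rat_hom.map_poly_pcompose poly_pcompose poly_monom)
qed

text \<open>
  A tower of finite extensions: any element lies in one of the rings \<open>\<rat>[zeta (p ^ a)]\<close>, which are closed
  under inverses by the quasi-inverse above.
\<close>

lemma Q_field_as_polynomial:
  assumes p: "Factorial_Ring.prime p" and "z \<in> Q_field p"
  shows "\<exists>a P. z = rpoly P (zeta (p ^ a))"
  using assms(2) unfolding Q_field_def
proof (induction)
  case one
  show ?case by (intro exI[of _ "0::nat"] exI[of _ "1 :: rat poly"]) (simp add: rpoly_simps)
next
  case (incl h)
  then show ?case
  proof
    assume "h \<in> \<rat>"
    then obtain r where "h = of_rat r" by (auto elim: Rats_cases)
    then show ?thesis by (intro exI[of _ "0::nat"] exI[of _ "[:r:]"]) (simp only: rpoly_simps)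
  next
    assume "h \<in> {z. \<exists>a>0. z ^ (p ^ a) = 1}"
    then obtain a where a: "h ^ (p ^ a) = 1" by blast
    have "p ^ a > 0" using p by (simp add: prime_gt_0_nat)
    then obtain j where "h = zeta (p ^ a) ^ j"
      using root_of_unity_power_form[OF _ a] by metis
    then show ?thesis
      by (intro exI[of _ a] exI[of _ "Polynomial.monom 1 j"]) (simp only: rpoly_simps of_rat_1 mult_1)
  qed
next
  case (a_inv h)
  then obtain a P where "h = rpoly P (zeta (p ^ a))" by blast
  then show ?case
    by (intro exI[of _ a] exI[of _ "- P"]) (simp only: rpoly_simps class_ring_simps)
next
  case (m_inv h)
  then obtain a P where h: "h = rpoly P (zeta (p ^ a))" by blast
  have pa: "p ^ a > 0" using p by (simp add: prime_gt_0_nat)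
  obtain R where "rpoly P (zeta (p ^ a)) \<noteq> 0 \<Longrightarrow> rpoly P (zeta (p ^ a)) * rpoly R (zeta (p ^ a)) = 1"
    using rational_polynomial_quasi_inverse[OF pa, of P] zeta_power_eq_1[OF pa] by metis
  then have "h * rpoly R (zeta (p ^ a)) = 1" using h m_inv.hyps by (simp add: class_ring_simps)
  then have "inverse h = rpoly R (zeta (p ^ a))" by (rule inverse_unique)
  then show ?case using m_inv.hyps
    by (intro exI[of _ a] exI[of _ R]) (simp add: class_ring_simps)
next
  case (eng_add h1 h2)
  then obtain a b P Q where h: "h1 = rpoly P (zeta (p ^ a))" "h2 = rpoly Q (zeta (p ^ b))" by blast
  have pa: "p ^ k > 0" for k using p by (simp add: prime_gt_0_nat)
  have "h1 = rpoly (pcompose P (Polynomial.monom 1 (p ^ b))) (zeta (p ^ (a + b)))"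
    using zeta_mult_power[OF pa, of "p ^ a" b] by (simp only: rpoly_pcompose_monom h power_add)
  moreover have "h2 = rpoly (pcompose Q (Polynomial.monom 1 (p ^ a))) (zeta (p ^ (a + b)))"
    using zeta_mult_power[OF pa, of "p ^ b" a] by (simp only: rpoly_pcompose_monom h power_add mult.commute)
  ultimately show ?case
    by (intro exI[of _ "a + b"] 
      exI[of _ "pcompose P (Polynomial.monom 1 (p ^ b)) + pcompose Q (Polynomial.monom 1 (p ^ a))"]) 
      (simp only: rpoly_simps class_ring_simps)
next
  case (eng_mult h1 h2)
  then obtain a b P Q where h: "h1 = rpoly P (zeta (p ^ a))" "h2 = rpoly Q (zeta (p ^ b))" by blast
  have pa: "p ^ k > 0" for k using p by (simp add: prime_gt_0_nat)
  have "h1 = rpoly (pcompose P (Polynomial.monom 1 (p ^ b))) (zeta (p ^ (a + b)))"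
    using zeta_mult_power[OF pa, of "p ^ a" b] by (simp only: rpoly_pcompose_monom h power_add)
  moreover have "h2 = rpoly (pcompose Q (Polynomial.monom 1 (p ^ a))) (zeta (p ^ (a + b)))"
    using zeta_mult_power[OF pa, of "p ^ b" a] by (simp only: rpoly_pcompose_monom h power_add mult.commute)
  ultimately show ?case
    by (intro exI[of _ "a + b"] 
      exI[of _ "pcompose P (Polynomial.monom 1 (p ^ b)) * pcompose Q (Polynomial.monom 1 (p ^ a))"]) 
      (simp only: rpoly_simps class_ring_simps)
qed

text \<open>
  Sorting all exponents modulo \<open>m\<close> by their greatest common divisor with \<open>m\<close> writes the full sum of
  powers of \<open>w\<close>, which is \<open>m\<close> or \<open>0\<close>, as a sum of Ramanujan sums for the divisors of \<open>m\<close>; all but the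
  wanted one belong to smaller moduli.
\<close>

lemma ramanujan_sum_rational:
  fixes w :: complex
  assumes "m > 0" "w ^ m = 1"
  shows "(\<Sum>u\<in>totatives m. w ^ u) \<in> \<rat>"
  using assms
proof (induction m arbitrary: w rule: less_induct)
  case (less m)
  have part: "{0<..m} = (\<Union>d\<in>{d. d dvd m}. {k\<in>{0<..m}. gcd k m = d})" by auto
  have "(\<Sum>k\<in>{0<..m}. w ^ k) = (\<Sum>d | d dvd m. \<Sum>k\<in>{k\<in>{0<..m}. gcd k m = d}. w ^ k)"
    by (subst part, rule sum.UNION_disjoint) (use less.prems in auto)
  also have "\<dots> = (\<Sum>d | d dvd m. \<Sum>u\<in>totatives (m div d). (w ^ d) ^ u)"
  proof (rule sum.cong[OF refl])
    fix d assume "d \<in> {d. d dvd m}"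
    then have d: "d dvd m" by simp
    have "(\<Sum>k\<in>{k\<in>{0<..m}. gcd k m = d}. w ^ k) = (\<Sum>u\<in>totatives (m div d). w ^ (u * d))"
      by (rule sum.reindex_bij_betw[symmetric, OF bij_betw_totatives_gcd_eq]) (use d less.prems in auto)
    then show "(\<Sum>k\<in>{k\<in>{0<..m}. gcd k m = d}. w ^ k) = (\<Sum>u\<in>totatives (m div d). (w ^ d) ^ u)"
      by (simp add: power_mult[symmetric] mult.commute)
  qed
  also have "\<dots> = (\<Sum>u\<in>totatives m. w ^ u) + (\<Sum>d\<in>{d. d dvd m} - {1}. \<Sum>u\<in>totatives (m div d). (w ^ d) ^ u)"
    by (subst sum.remove[of _ 1]) (use less.prems in auto)
  finally have eq: "(\<Sum>u\<in>totatives m. w ^ u) = (\<Sum>k\<in>{0<..m}. w ^ k) - 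
    (\<Sum>d\<in>{d. d dvd m} - {1}. \<Sum>u\<in>totatives (m div d). (w ^ d) ^ u)" by simp
  have "(\<Sum>d\<in>{d. d dvd m} - {1}. \<Sum>u\<in>totatives (m div d). (w ^ d) ^ u) \<in> \<rat>"
  proof (rule Rats_sum)
    fix d assume "d \<in> {d. d dvd m} - {1}"
    then have d: "d dvd m" "d > 1" using less.prems by (auto intro!: Nat.gr0I simp: nat_neq_iff)
    show "(\<Sum>u\<in>totatives (m div d). (w ^ d) ^ u) \<in> \<rat>"
    proof (rule less.IH)
      show "m div d < m" using d less.prems by simp
      show "0 < m div d" using d less.prems by (simp add: div_greater_zero_iff dvd_imp_le)
      show "(w ^ d) ^ (m div d) = 1" using d less.prems by (simp add: power_mult[symmetric])
    qed
  qed
  moreover have "(\<Sum>k\<in>{0<..m}. w ^ k) \<in> \<rat>"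
  proof -
    have "(\<Sum>k\<in>{0<..m}. w ^ k) = w * (\<Sum>k<m. w ^ k)"
      unfolding sum_distrib_left
      by (rule sum.reindex_bij_witness[of _ Suc "\<lambda>k. k - 1"]) (auto simp flip: power_Suc)
    also have "\<dots> = (if w = 1 then of_nat m else 0)"
      using sum_powers_root_of_unity[OF less.prems(2)] by simp
    finally show ?thesis by simp
  qed
  ultimately show ?case unfolding eq by (rule Rats_diff[rotated])
qed

section \<open>Traces\<close>

lemma mult_mat_entry:
  assumes "A \<in> carrier_mat n m" "B \<in> carrier_mat m k" "i < n" "j < k"
  shows "(A * B) $$ (i, j) = (\<Sum>l<m. A $$ (i, l) * B $$ (l, j))"
  using assms by (auto simp: scalar_prod_def lessThan_atLeast0)

lemma mat_trace_carrier: "A \<in> carrier_mat n n \<Longrightarrow> mat_trace A = (\<Sum>i<n. A $$ (i, i))"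
  by (simp add: mat_trace_def)

lemma mat_trace_mult_commute:
  fixes A :: "'a :: comm_ring_1 mat"
  assumes A: "A \<in> carrier_mat n m" and B: "B \<in> carrier_mat m n"
  shows "mat_trace (A * B) = mat_trace (B * A)"
proof -
  have "mat_trace (A * B) = (\<Sum>i<n. \<Sum>l<m. A $$ (i, l) * B $$ (l, i))"
    unfolding mat_trace_carrier[OF mult_carrier_mat[OF A B]]
    by (intro sum.cong refl mult_mat_entry[OF A B]) auto
  also have "\<dots> = (\<Sum>l<m. \<Sum>i<n. B $$ (l, i) * A $$ (i, l))"
    by (subst sum.swap) (simp add: mult.commute)
  also have "\<dots> = mat_trace (B * A)"
    unfolding mat_trace_carrier[OF mult_carrier_mat[OF B A]]
    by (intro sum.cong refl mult_mat_entry[OF B A, symmetric]) auto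
  finally show ?thesis .
qed

lemma mat_trace_conjugate:
  fixes A :: "'a :: comm_ring_1 mat"
  assumes "A \<in> carrier_mat n n" "P \<in> carrier_mat n n" "Q \<in> carrier_mat n n" "P * Q = 1\<^sub>m n"
  shows "mat_trace (Q * A * P) = mat_trace A"
proof -
  have "mat_trace (Q * A * P) = mat_trace (P * (Q * A))"
    by (rule mat_trace_mult_commute[of _ n n]) (use assms in auto)
  also have "P * (Q * A) = A"
    using assms by (simp add: assoc_mult_mat[symmetric, of _ n n _ n _ n])
  finally show ?thesis .
qed

lemma mat_trace_smult:
  "A \<in> carrier_mat d d \<Longrightarrow> mat_trace (c \<cdot>\<^sub>m A) = c * mat_trace (A :: complex mat)"
  by (simp add: mat_trace_def sum_distrib_left)

lemma upper_triangular_power: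
  fixes B :: "'a :: comm_ring_1 mat"
  assumes B: "B \<in> carrier_mat n n" and "upper_triangular B"
  shows "upper_triangular (B ^\<^sub>m k) \<and> (\<forall>i<n. (B ^\<^sub>m k) $$ (i, i) = (B $$ (i, i)) ^ k)"
proof (induction k)
  case 0
  then show ?case using B by auto
next
  case (Suc k)
  let ?C = "B ^\<^sub>m k"
  have C: "?C \<in> carrier_mat n n" using B by simp
  have entry: "(?C * B) $$ (i, j) = (\<Sum>l<n. ?C $$ (i, l) * B $$ (l, j))" if "i < n" "j < n" for i j
    by (rule mult_mat_entry[OF C B that])
  have C0: "?C $$ (i, j) = 0" if "j < i" "i < n" for i j
    using Suc C that by (auto simp: upper_triangular_def)
  have B0: "B $$ (i, j) = 0" if "j < i" "i < n" for i j
    using assms that by (auto simp: upper_triangular_def)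
  have "(?C * B) $$ (i, j) = 0" if "j < i" "i < n" for i j
    unfolding entry[OF \<open>i < n\<close> less_trans[OF \<open>j < i\<close> \<open>i < n\<close>]]
  proof (intro sum.neutral ballI)
    fix l assume "l \<in> {..<n}"
    then show "?C $$ (i, l) * B $$ (l, j) = 0"
      using C0[of l i] B0[of j l] that by (cases "l < i") auto
  qed
  then have "upper_triangular (?C * B)" using C B by (auto simp: upper_triangular_def)
  moreover have "(?C * B) $$ (i, i) = (B $$ (i, i)) ^ Suc k" if i: "i < n" for i
  proof -
    have "(?C * B) $$ (i, i) = (\<Sum>l<n. if l = i then ?C $$ (i, i) * B $$ (i, i) else 0)"
      unfolding entry[OF i i] by (intro sum.cong refl) (use C0[of _ i] B0[of i] i in \<open>force simp: nat_neq_iff\<close>)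
    then show ?thesis using Suc i by (simp add: mult.commute)
  qed
  ultimately show ?case by simp
qed

text \<open>
  Triangularise \<open>A\<close>; powers of a triangular matrix have the powers of the diagonal entries on the
  diagonal.
\<close>

lemma trace_powers_eigenvalues:
  fixes A :: "complex mat"
  assumes A: "A \<in> carrier_mat n n"
  obtains es where "\<And>k. mat_trace (A ^\<^sub>m k) = (\<Sum>e\<leftarrow>es. e ^ k)"
    "\<And>N e. A ^\<^sub>m N = 1\<^sub>m n \<Longrightarrow> e \<in> set es \<Longrightarrow> e ^ N = 1"
proof -
  obtain as where "char_poly A = (\<Prod>a\<leftarrow>as. [:- a, 1:])" using char_poly_factorized[OF A] by blast
  then obtain B where B: "upper_triangular B" "similar_mat A B"
    using schur_decomposition_exists[OF A] by blast
  then obtain P Q where w: "similar_mat_wit A B P Q" by (auto simp: similar_mat_def)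
  note wD = similar_mat_witD2[OF A w]
  have Bn: "B \<in> carrier_mat n n" and P: "P \<in> carrier_mat n n" and Q: "Q \<in> carrier_mat n n" using wD by auto
  have diag: "(B ^\<^sub>m k) $$ (i, i) = (B $$ (i, i)) ^ k" if "i < n" for i k
    using upper_triangular_power[OF Bn B(1)] that by blast
  define es where "es = map (\<lambda>i. B $$ (i, i)) [0..<n]"
  show thesis
  proof (rule that[of es])
    fix k
    have "mat_trace (A ^\<^sub>m k) = mat_trace (P * B ^\<^sub>m k * Q)"
      by (simp add: similar_mat_wit_pow_id[OF w])
    also have "\<dots> = mat_trace (B ^\<^sub>m k)"
      by (rule mat_trace_conjugate[of _ n]) (use wD Bn in auto)
    also have "\<dots> = (\<Sum>i<n. (B $$ (i, i)) ^ k)"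
      using Bn by (simp add: mat_trace_carrier[of _ n] diag)
    also have "\<dots> = (\<Sum>e\<leftarrow>es. e ^ k)"
      by (simp add: es_def comp_def interv_sum_list_conv_sum_set_nat lessThan_atLeast0)
    finally show "mat_trace (A ^\<^sub>m k) = (\<Sum>e\<leftarrow>es. e ^ k)" .
  next
    fix N e assume AN: "A ^\<^sub>m N = 1\<^sub>m n" and "e \<in> set es"
    then obtain i where i: "i < n" "e = B $$ (i, i)" by (auto simp: es_def)
    have "B ^\<^sub>m N = Q * A ^\<^sub>m N * P"
      by (rule similar_mat_wit_pow_id[OF similar_mat_wit_sym[OF w]])
    then have "B ^\<^sub>m N = 1\<^sub>m n" unfolding AN using wD(2) Q by simp
    then show "e ^ N = 1" using diag[OF i(1), of N] i by simp
  qed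
qed

section \<open>Averaging over an irreducible representation\<close>

lemma representationD:
  assumes G: "group G" and rep: "representation G n \<rho>"
  shows "g \<in> carrier G \<Longrightarrow> \<rho> g \<in> carrier_mat n n"
    and "g \<in> carrier G \<Longrightarrow> h \<in> carrier G \<Longrightarrow> \<rho> (g \<otimes>\<^bsub>G\<^esub> h) = \<rho> g * \<rho> h"
    and "\<rho> \<one>\<^bsub>G\<^esub> = 1\<^sub>m n"
proof -
  let ?R = "ring_mat TYPE(complex) n ()"
  interpret G: group G by fact
  interpret R: ring ?R by (rule ring_mat)
  have hom: "\<rho> \<in> hom G (units_of ?R)" using rep by (simp add: representation_def)
  interpret group_hom G "units_of ?R" \<rho>
    by (intro group_hom.intro group_hom_axioms.intro G.group_axioms R.units_group hom)
  show "g \<in> carrier G \<Longrightarrow> \<rho> g \<in> carrier_mat n n"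
    using hom_closed[of g] by (auto simp: units_of_def Units_def ring_mat_def)
  show "g \<in> carrier G \<Longrightarrow> h \<in> carrier G \<Longrightarrow> \<rho> (g \<otimes>\<^bsub>G\<^esub> h) = \<rho> g * \<rho> h"
    using hom_mult[of g h] by (simp add: units_of_def ring_mat_def)
  show "\<rho> \<one>\<^bsub>G\<^esub> = 1\<^sub>m n"
    using hom_one by (simp add: units_of_def ring_mat_def)
qed

lemma representationI:
  assumes G: "group G"
    and car: "\<And>g. g \<in> carrier G \<Longrightarrow> \<rho> g \<in> carrier_mat n n"
    and mult: "\<And>g h. g \<in> carrier G \<Longrightarrow> h \<in> carrier G \<Longrightarrow> \<rho> (g \<otimes>\<^bsub>G\<^esub> h) = \<rho> g * \<rho> h"
    and one: "\<rho> \<one>\<^bsub>G\<^esub> = 1\<^sub>m n"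
  shows "representation G n \<rho>"
proof -
  interpret G: group G by fact
  have "\<rho> g \<in> Units (ring_mat TYPE(complex) n ())" if g: "g \<in> carrier G" for g
  proof -
    have "\<rho> (inv\<^bsub>G\<^esub> g) * \<rho> g = 1\<^sub>m n" "\<rho> g * \<rho> (inv\<^bsub>G\<^esub> g) = 1\<^sub>m n"
      using g mult[of "inv\<^bsub>G\<^esub> g" g] mult[of g "inv\<^bsub>G\<^esub> g"] one by simp_all
    then show ?thesis using g car[of g] car[of "inv\<^bsub>G\<^esub> g"] by (auto simp: Units_def ring_mat_def)
  qed
  then show ?thesis unfolding representation_def
    by (auto simp: hom_def units_of_def ring_mat_def mult)
qed

lemma vec_subspaceI:
  assumes "W \<subseteq> carrier_vec n" "0\<^sub>v n \<in> W"
    and "\<And>v w. v \<in> W \<Longrightarrow> w \<in> W \<Longrightarrow> v + w \<in> W" "\<And>c v. v \<in> W \<Longrightarrow> c \<cdot>\<^sub>v v \<in> W"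
  shows "VectorSpace.subspace class_ring W (module_vec TYPE('a :: field) n)"
proof -
  interpret vec_space "TYPE('a)" n .
  show ?thesis unfolding VectorSpace.subspace_def submodule_def
    using assms module_axioms vectorspace_axioms by (auto simp: module_vec_def)
qed

text \<open>
  Schur's lemma, for endomorphisms only: an eigenspace of \<open>M\<close> is invariant, hence everything.
\<close>

lemma schur_scalar:
  assumes G: "group G" and irr: "irreducible_representation G n \<rho>"
    and M: "M \<in> carrier_mat n n"
    and comm: "\<And>g. g \<in> carrier G \<Longrightarrow> \<rho> g * M = M * \<rho> g"
  obtains c where "M = c \<cdot>\<^sub>m 1\<^sub>m n"
proof -
  have rep: "representation G n \<rho>" and n: "n > 0" 
    and inv: "\<And>W. invariant_subspace G n \<rho> W \<Longrightarrow> W = {0\<^sub>v n} \<or> W = carrier_vec n"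
    using irr by (auto simp: irreducible_representation_def)
  note \<rho> = representationD(1)[OF G rep]
  have "\<not> constant (poly (char_poly M))"
    using n degree_monic_char_poly[OF M] by (simp add: constant_degree)
  then obtain c where "poly (char_poly M) c = 0" using fundamental_theorem_of_algebra by blast
  then have "eigenvalue M c" using eigenvalue_root_char_poly[OF M] by simp
  then obtain v where v: "v \<in> carrier_vec n" "v \<noteq> 0\<^sub>v n" "M *\<^sub>v v = c \<cdot>\<^sub>v v"
    using M by (auto simp: eigenvalue_def eigenvector_def)
  define W where "W = {w \<in> carrier_vec n. M *\<^sub>v w = c \<cdot>\<^sub>v w}"
  have "invariant_subspace G n \<rho> W"
    unfolding invariant_subspace_def
  proof (intro conjI ballI)
    show "VectorSpace.subspace class_ring W (module_vec TYPE(complex) n)"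
    proof (rule vec_subspaceI)
      show "0\<^sub>v n \<in> W" using M by (auto simp: W_def)
      show "x + y \<in> W" if "x \<in> W" "y \<in> W" for x y
        using that M by (auto simp: W_def mult_add_distrib_mat_vec smult_add_distrib_vec)
      show "a \<cdot>\<^sub>v x \<in> W" if "x \<in> W" for a x
        using that M by (auto simp: W_def mult_mat_vec smult_smult_assoc mult.commute)
    qed (auto simp: W_def)
  next
    fix g w assume g: "g \<in> carrier G" and "w \<in> W"
    then have w: "w \<in> carrier_vec n" "M *\<^sub>v w = c \<cdot>\<^sub>v w" by (auto simp: W_def)
    have "M *\<^sub>v (\<rho> g *\<^sub>v w) = (M * \<rho> g) *\<^sub>v w" using M \<rho>[OF g] w by simp
    also have "\<dots> = \<rho> g *\<^sub>v (M *\<^sub>v w)" using M \<rho>[OF g] w by (simp add: comm[OF g, symmetric])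
    also have "\<dots> = c \<cdot>\<^sub>v (\<rho> g *\<^sub>v w)" using M \<rho>[OF g] w by (simp add: mult_mat_vec)
    finally show "\<rho> g *\<^sub>v w \<in> W" using \<rho>[OF g] w by (auto simp: W_def)
  qed
  moreover have "v \<in> W" using v by (simp add: W_def)
  ultimately have W: "W = carrier_vec n" using inv v(2) by blast
  have "M = c \<cdot>\<^sub>m 1\<^sub>m n"
  proof (rule mat_col_eqI)
    fix j assume "j < dim_col (c \<cdot>\<^sub>m 1\<^sub>m n :: complex mat)"
    then have j: "j < n" by simp
    have "unit_vec n j \<in> W" using W by simp
    then have "M *\<^sub>v unit_vec n j = c \<cdot>\<^sub>v unit_vec n j" by (simp add: W_def)
    moreover have "M *\<^sub>v unit_vec n j = col M j" 
      by (rule eq_vecI) (use M j in \<open>auto simp: scalar_prod_def unit_vec_def if_distrib cong: if_cong\<close>)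
    ultimately show "col M j = col (c \<cdot>\<^sub>m 1\<^sub>m n) j" using j by (auto simp: unit_vec_def)
  qed (use M in auto)
  then show thesis by (rule that)
qed

text \<open>
  Indexed sums are taken entrywise with the dimension as a parameter: the type of matrices is not a
  monoid under addition, as its zero depends on the dimension.
\<close>

definition mat_sum :: "nat \<Rightarrow> ('a \<Rightarrow> complex mat) \<Rightarrow> 'a set \<Rightarrow> complex mat" where
  "mat_sum n f T = mat n n (\<lambda>(i, j). \<Sum>t\<in>T. f t $$ (i, j))"

lemma mat_sum_carrier [simp]: "mat_sum n f T \<in> carrier_mat n n"
  by (simp add: mat_sum_def)

lemma mat_sum_mult_left:
  assumes A: "A \<in> carrier_mat n n" and f: "\<And>t. t \<in> T \<Longrightarrow> f t \<in> carrier_mat n n"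
  shows "A * mat_sum n f T = mat_sum n (\<lambda>t. A * f t) T"
proof (rule eq_matI)
  fix i j assume "i < dim_row (mat_sum n (\<lambda>t. A * f t) T)" "j < dim_col (mat_sum n (\<lambda>t. A * f t) T)"
  then have ij: "i < n" "j < n" by (auto simp: mat_sum_def)
  have "(A * mat_sum n f T) $$ (i, j) = (\<Sum>l<n. \<Sum>t\<in>T. A $$ (i, l) * f t $$ (l, j))"
    by (subst mult_mat_entry[OF A mat_sum_carrier ij]) (simp add: mat_sum_def ij sum_distrib_left)
  also have "\<dots> = (\<Sum>t\<in>T. (A * f t) $$ (i, j))"
    by (subst sum.swap) (intro sum.cong refl mult_mat_entry[OF A f ij, symmetric])
  finally show "(A * mat_sum n f T) $$ (i, j) = mat_sum n (\<lambda>t. A * f t) T $$ (i, j)"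
    using ij by (simp add: mat_sum_def)
qed (use A in \<open>auto simp: mat_sum_def\<close>)

lemma mat_sum_mult_right:
  assumes A: "A \<in> carrier_mat n n" and f: "\<And>t. t \<in> T \<Longrightarrow> f t \<in> carrier_mat n n"
  shows "mat_sum n f T * A = mat_sum n (\<lambda>t. f t * A) T"
proof (rule eq_matI)
  fix i j assume "i < dim_row (mat_sum n (\<lambda>t. f t * A) T)" "j < dim_col (mat_sum n (\<lambda>t. f t * A) T)"
  then have ij: "i < n" "j < n" by (auto simp: mat_sum_def)
  have "(mat_sum n f T * A) $$ (i, j) = (\<Sum>l<n. \<Sum>t\<in>T. f t $$ (i, l) * A $$ (l, j))"
    by (subst mult_mat_entry[OF mat_sum_carrier A ij]) (simp add: mat_sum_def ij sum_distrib_right)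
  also have "\<dots> = (\<Sum>t\<in>T. (f t * A) $$ (i, j))"
    by (subst sum.swap) (intro sum.cong refl mult_mat_entry[OF f A ij, symmetric])
  finally show "(mat_sum n f T * A) $$ (i, j) = mat_sum n (\<lambda>t. f t * A) T $$ (i, j)"
    using ij by (simp add: mat_sum_def)
qed (use A in \<open>auto simp: mat_sum_def\<close>)

lemma mat_trace_mat_sum:
  assumes f: "\<And>t. t \<in> T \<Longrightarrow> f t \<in> carrier_mat n n"
  shows "mat_trace (mat_sum n f T) = (\<Sum>t\<in>T. mat_trace (f t))"
proof -
  have "mat_trace (mat_sum n f T) = (\<Sum>i<n. \<Sum>t\<in>T. f t $$ (i, i))"
    by (subst mat_trace_carrier[OF mat_sum_carrier]) (simp add: mat_sum_def)
  also have "\<dots> = (\<Sum>t\<in>T. mat_trace (f t))"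
    by (subst sum.swap) (simp add: mat_trace_carrier[OF f])
  finally show ?thesis .
qed

lemma mat_sum_cong: "(\<And>t. t \<in> T \<Longrightarrow> f t = g t) \<Longrightarrow> mat_sum n f T = mat_sum n g T"
  by (simp add: mat_sum_def)

lemma mat_sum_reindex:
  assumes "bij_betw h S T"
  shows "mat_sum n (\<lambda>t. f (h t)) S = mat_sum n f T"
proof -
  have "(\<Sum>t\<in>S. f (h t) $$ (i, j)) = (\<Sum>t\<in>T. f t $$ (i, j))" for i j
    by (rule sum.reindex_bij_betw[OF assms])
  then show ?thesis unfolding mat_sum_def by simp
qed

text \<open>
  The average commutes with the representation, so it is scalar by Schur's lemma, and the trace
  determines the scalar.
\<close>

lemma irreducible_average:
  assumes G: "group G" and irr: "irreducible_representation G n \<rho>"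
    and X: "X \<in> carrier_mat n n"
  shows "mat_sum n (\<lambda>t. \<rho> t * X * \<rho> (inv\<^bsub>G\<^esub> t)) (carrier G) =
    (of_nat (Coset.order G) * mat_trace X / of_nat n) \<cdot>\<^sub>m 1\<^sub>m n"
proof -
  interpret G: group G by fact
  have rep: "representation G n \<rho>" and n: "n > 0" 
    using irr by (auto simp: irreducible_representation_def)
  note \<rho> = representationD[OF G rep]
  let ?S = "mat_sum n (\<lambda>t. \<rho> t * X * \<rho> (inv\<^bsub>G\<^esub> t)) (carrier G)"
  have car: "\<rho> t * X * \<rho> (inv\<^bsub>G\<^esub> t) \<in> carrier_mat n n" if "t \<in> carrier G" for t
    using \<rho>(1) X that by (intro mult_carrier_mat[of _ n n]) auto
  have comm: "\<rho> g * ?S = ?S * \<rho> g" if g: "g \<in> carrier G" for g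
  proof -
    have "\<rho> g * ?S = mat_sum n (\<lambda>t. \<rho> g * (\<rho> t * X * \<rho> (inv\<^bsub>G\<^esub> t))) (carrier G)"
      by (rule mat_sum_mult_left[OF \<rho>(1)[OF g] car])
    also have "\<dots> = mat_sum n (\<lambda>t. \<rho> (g \<otimes>\<^bsub>G\<^esub> t) * X * \<rho> (inv\<^bsub>G\<^esub> (g \<otimes>\<^bsub>G\<^esub> t)) * \<rho> g) (carrier G)"
    proof (rule mat_sum_cong)
      fix t assume t: "t \<in> carrier G"
      note cars = \<rho>(1)[OF g] \<rho>(1)[OF t] \<rho>(1)[OF G.inv_closed[OF t]] \<rho>(1)[OF G.m_closed[OF g t]]
        \<rho>(1)[OF G.inv_closed[OF G.m_closed[OF g t]]] X
      have e1: "\<rho> (g \<otimes>\<^bsub>G\<^esub> t) * X * \<rho> (inv\<^bsub>G\<^esub> (g \<otimes>\<^bsub>G\<^esub> t)) * \<rho> g =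
        \<rho> (g \<otimes>\<^bsub>G\<^esub> t) * X * (\<rho> (inv\<^bsub>G\<^esub> (g \<otimes>\<^bsub>G\<^esub> t)) * \<rho> g)"
        using cars by (intro assoc_mult_mat[of _ n n _ n _ n] mult_carrier_mat[of _ n n])
      have e2: "\<rho> (inv\<^bsub>G\<^esub> (g \<otimes>\<^bsub>G\<^esub> t)) * \<rho> g = \<rho> (inv\<^bsub>G\<^esub> t)"
        using g t by (simp add: \<rho>(2)[symmetric] G.inv_mult_group G.m_assoc)
      have e3: "\<rho> (g \<otimes>\<^bsub>G\<^esub> t) = \<rho> g * \<rho> t" using g t by (rule \<rho>(2))
      have e4: "\<rho> g * \<rho> t * X * \<rho> (inv\<^bsub>G\<^esub> t) = \<rho> g * (\<rho> t * X * \<rho> (inv\<^bsub>G\<^esub> t))"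
        using cars by (simp add: assoc_mult_mat[of _ n n _ n _ n])
      show "\<rho> g * (\<rho> t * X * \<rho> (inv\<^bsub>G\<^esub> t)) =
        \<rho> (g \<otimes>\<^bsub>G\<^esub> t) * X * \<rho> (inv\<^bsub>G\<^esub> (g \<otimes>\<^bsub>G\<^esub> t)) * \<rho> g"
        by (subst e1, subst e2, subst e3, subst e4, rule refl)
    qed
    also have "\<dots> = mat_sum n (\<lambda>t. \<rho> t * X * \<rho> (inv\<^bsub>G\<^esub> t) * \<rho> g) (carrier G)"
      by (rule mat_sum_reindex[where f = "\<lambda>t. \<rho> t * X * \<rho> (inv\<^bsub>G\<^esub> t) * \<rho> g"],
          rule bij_betw_byWitness[where f' = "\<lambda>t. inv\<^bsub>G\<^esub> g \<otimes>\<^bsub>G\<^esub> t"])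
        (use g in \<open>auto simp: G.m_assoc[symmetric]\<close>)
    also have "\<dots> = ?S * \<rho> g"
      by (rule mat_sum_mult_right[OF \<rho>(1)[OF g] car, symmetric])
    finally show ?thesis .
  qed
  obtain c where c: "?S = c \<cdot>\<^sub>m 1\<^sub>m n"
    by (rule schur_scalar[OF G irr mat_sum_carrier comm])
  have "mat_trace ?S = (\<Sum>t\<in>carrier G. mat_trace X)"
  proof (subst mat_trace_mat_sum[OF car], assumption, rule sum.cong[OF refl])
    fix t assume t: "t \<in> carrier G"
    have "\<rho> (inv\<^bsub>G\<^esub> t) * \<rho> t = 1\<^sub>m n"
      using t \<rho>(2)[of "inv\<^bsub>G\<^esub> t" t] \<rho>(3) by simp
    then show "mat_trace (\<rho> t * X * \<rho> (inv\<^bsub>G\<^esub> t)) = mat_trace X"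
      using mat_trace_conjugate[OF X, of "\<rho> (inv\<^bsub>G\<^esub> t)" "\<rho> t"] \<rho>(1) t by simp
  qed
  then have "mat_trace ?S = of_nat (Coset.order G) * mat_trace X" by (simp add: Coset.order_def)
  moreover have "mat_trace ?S = of_nat n * c"
    unfolding c by (subst mat_trace_carrier[of _ n]) auto
  ultimately have "c = of_nat (Coset.order G) * mat_trace X / of_nat n"
    using n by (simp add: field_simps)
  then show ?thesis using c by simp
qed

section \<open>Decomposition into irreducible characters\<close>

lemma (in vec_space) extend_independent_set:
  assumes X: "X \<subseteq> carrier_vec n" and S: "S \<subseteq> X" "lin_indpt S"
  obtains T where "S \<subseteq> T" "T \<subseteq> X" "lin_indpt T" "finite T" "X \<subseteq> span T"
proof -
  let ?P = "\<lambda>T. S \<subseteq> T \<and> T \<subseteq> X \<and> lin_indpt T"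
  have bound: "finite T \<and> card T \<le> dim" if "?P T" for T
    using li_le_dim[OF fin_dim, of T] that X by (auto simp: module_vec_def)
  obtain T where T: "?P T" and max: "\<And>T'. ?P T' \<Longrightarrow> card T' \<le> card T"
    using ex_has_greatest_nat[of ?P S card "Suc dim"] S bound by (metis less_Suc_eq_le order_refl)
  have "w \<in> span T" if w: "w \<in> X" for w
  proof (rule ccontr)
    assume nw: "w \<notin> span T"
    have TX: "T \<subseteq> carrier_vec n" using T X by auto
    have "w \<notin> T" using nw TX in_own_span[of T] by auto
    moreover have "lin_indpt (T \<union> {w})"
      using lin_dep_iff_in_span[of T w] nw T TX w X \<open>w \<notin> T\<close> by (auto simp: module_vec_def)
    ultimately have "card (T \<union> {w}) \<le> card T" using T w by (intro max) auto
    then show False using bound[OF T] \<open>w \<notin> T\<close> by simp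
  qed
  then show thesis using that T bound[OF T] by blast
qed

lemma vec_subspaceD:
  assumes "VectorSpace.subspace class_ring W (module_vec TYPE('a :: field) n)"
  shows "W \<subseteq> carrier_vec n" "0\<^sub>v n \<in> W" "submodule class_ring W (module_vec TYPE('a :: field) n)"
  using assms unfolding VectorSpace.subspace_def submodule_def by (auto simp: module_vec_def)

text \<open>
  The columns of \<open>P\<close> are a basis of \<open>W\<close> followed by a completion to a basis of the whole space. The last
  property says that in the new coordinates \<open>W\<close> is contained in the span of the first \<open>r\<close> vectors.
\<close>

lemma adapted_basis:
  fixes W :: "complex vec set"
  assumes W: "VectorSpace.subspace class_ring W (module_vec TYPE(complex) m)"
    and "W \<noteq> {0\<^sub>v m}" "W \<noteq> carrier_vec m"
  obtains P Q r where "P \<in> carrier_mat m m" "Q \<in> carrier_mat m m" "P * Q = 1\<^sub>m m" "Q * P = 1\<^sub>m m"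
    "0 < r" "r < m" "\<And>j. j < r \<Longrightarrow> col P j \<in> W"
    "\<And>w i. w \<in> W \<Longrightarrow> r \<le> i \<Longrightarrow> i < m \<Longrightarrow> (Q *\<^sub>v w) $ i = 0"
proof -
  interpret vec_space "TYPE(complex)" m .
  note WD = vec_subspaceD[OF W]
  have empty: "lin_indpt {}" using lin_dep_def by auto
  obtain S where S: "S \<subseteq> W" "lin_indpt S" "finite S" "W \<subseteq> span S"
    using extend_independent_set[OF WD(1) _ empty] by auto
  have spanS: "span S \<subseteq> W" by (rule span_is_subset[OF S(1) WD(3)])
  obtain T where T: "S \<subseteq> T" "T \<subseteq> carrier_vec m" "lin_indpt T" "finite T" "carrier_vec m \<subseteq> span T"
    using extend_independent_set[of "carrier_vec m" S] S WD(1) by blast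
  have "basis T" unfolding basis_def using T span_is_subset2[of T] by (auto simp: module_vec_def)
  then have cardT: "card T = m" using dim_basis[OF T(4)] dim_is_n by simp
  obtain xs ys where xs: "set xs = S" "distinct xs" and ys: "set ys = T - S" "distinct ys"
    using finite_distinct_list S(3) T(4) by (metis finite_Diff)
  define bs where "bs = xs @ ys"
  define r where "r = length xs"
  have bs: "set bs = T" "distinct bs" using xs ys T(1) by (auto simp: bs_def)
  then have len: "length bs = m" using cardT by (metis distinct_card)
  define P where "P = mat_of_cols m bs"
  have P: "P \<in> carrier_mat m m" by (simp add: P_def mat_of_cols_def len)
  have colsP: "cols P = bs" unfolding P_def by (rule cols_mat_of_cols) (use bs T in auto)
  have "det P \<noteq> 0"
  proof
    assume "det P = 0"
    then obtain v where "v \<in> carrier_vec m" "v \<noteq> 0\<^sub>v m" "P *\<^sub>v v = 0\<^sub>v m"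
      using det_0_iff_vec_prod_zero_field[OF P] by blast
    then have "lin_dep (set (cols P))" by (intro lin_depI[OF P]) (use colsP bs in auto)
    then show False using colsP bs T by simp
  qed
  then have "P \<in> Units (ring_mat TYPE(complex) m ())" by (rule det_non_zero_imp_unit[OF P])
  then obtain Q where Q: "Q \<in> carrier_mat m m" "Q * P = 1\<^sub>m m" "P * Q = 1\<^sub>m m"
    by (auto simp: Units_def ring_mat_def)
  have colP: "col P j = bs ! j" if "j < m" for j
    using that colsP P by (metis carrier_matD(2) cols_nth)
  have "r \<le> m" using len by (simp add: r_def bs_def)
  have "0 < r"
  proof (rule ccontr)
    assume "\<not> 0 < r"
    then have "S = {}" using xs by (simp add: r_def)
    then have "W \<subseteq> {0\<^sub>v m}" using S(4) span_empty by (simp add: module_vec_def)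
    then show False using WD(2) assms(2) by auto
  qed
  have "r < m"
  proof (rule ccontr)
    assume "\<not> r < m"
    then have "card S = card T" using \<open>r \<le> m\<close> xs cardT by (metis distinct_card le_neq_implies_less r_def)
    then have "S = T" using T by (simp add: card_subset_eq)
    then show False using T(5) spanS WD(1) assms(3) by auto
  qed
  define N where "N = {w \<in> carrier_vec m. \<forall>i. r \<le> i \<longrightarrow> i < m \<longrightarrow> (Q *\<^sub>v w) $ i = 0}"
  have "VectorSpace.subspace class_ring N (module_vec TYPE(complex) m)"
  proof (rule vec_subspaceI)
    show "0\<^sub>v m \<in> N" using Q by (auto simp: N_def)
    show "v + w \<in> N" if "v \<in> N" "w \<in> N" for v w
      using that Q(1) by (auto simp: N_def mult_add_distrib_mat_vec simp del: index_mult_mat_vec)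
    show "c \<cdot>\<^sub>v v \<in> N" if "v \<in> N" for c v
      using that Q(1) by (auto simp: N_def mult_mat_vec simp del: index_mult_mat_vec)
  qed (auto simp: N_def)
  moreover have "S \<subseteq> N"
  proof
    fix w assume w: "w \<in> S"
    then obtain j where j: "j < r" "w = xs ! j" using xs by (auto simp: in_set_conv_nth r_def)
    then have jm: "j < m" using \<open>r \<le> m\<close> by simp
    have "w = col P j" using j colP[OF jm] by (simp add: bs_def nth_append r_def)
    then have "Q *\<^sub>v w = col (Q * P) j" using col_mult2[OF Q(1) P jm] by metis
    then have "Q *\<^sub>v w = unit_vec m j" unfolding Q(2) using jm by simp
    moreover have "w \<in> carrier_vec m" using w S(1) WD(1) by blast
    ultimately show "w \<in> N" using j(1) by (auto simp: N_def unit_vec_def simp del: index_mult_mat_vec)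
  qed
  ultimately have "span S \<subseteq> N" using span_is_subset[OF _ vec_subspaceD(3)] by blast
  then have "W \<subseteq> N" using S(4) by blast
  show thesis
  proof (rule that[OF P Q(1) Q(3) Q(2) \<open>0 < r\<close> \<open>r < m\<close>])
    fix j assume j: "j < r"
    then have "col P j = xs ! j" using \<open>r < m\<close> colP[of j] by (simp add: bs_def nth_append r_def)
    then show "col P j \<in> W" using j xs S(1) by (auto simp: r_def)
  next
    fix w i assume "w \<in> W" "r \<le> i" "i < m"
    then show "(Q *\<^sub>v w) $ i = 0" using \<open>W \<subseteq> N\<close> by (auto simp: N_def)
  qed
qed

lemma representation_conjugate:
  assumes G: "group G" and rep: "representation G m \<rho>"
    and P: "P \<in> carrier_mat m m" "Q \<in> carrier_mat m m" "P * Q = 1\<^sub>m m" "Q * P = 1\<^sub>m m"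
  shows "representation G m (\<lambda>g. Q * \<rho> g * P)"
proof (rule representationI[OF G])
  note \<rho> = representationD[OF G rep]
  show "Q * \<rho> g * P \<in> carrier_mat m m" if "g \<in> carrier G" for g
    using \<rho>(1)[OF that] P by auto
  show "Q * \<rho> \<one>\<^bsub>G\<^esub> * P = 1\<^sub>m m" using P by (simp add: \<rho>(3))
  fix g h assume g: "g \<in> carrier G" and h: "h \<in> carrier G"
  note car = \<rho>(1)[OF g] \<rho>(1)[OF h] P(1,2)
  have "Q * \<rho> g * P * (Q * \<rho> h * P) = Q * \<rho> g * (P * Q) * (\<rho> h * P)"
    using car by (simp add: assoc_mult_mat[of _ m m _ m _ m])
  also have "\<dots> = Q * (\<rho> g * \<rho> h) * P"
    unfolding P(3) using car by (simp add: assoc_mult_mat[of _ m m _ m _ m])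
  finally show "Q * \<rho> (g \<otimes>\<^bsub>G\<^esub> h) * P = Q * \<rho> g * P * (Q * \<rho> h * P)"
    by (simp add: \<rho>(2)[OF g h])
qed

lemma block_triangular_representation:
  assumes G: "group G" and rep: "representation G m R" and r: "r \<le> m"
    and zero: "\<And>g i j. g \<in> carrier G \<Longrightarrow> j < r \<Longrightarrow> r \<le> i \<Longrightarrow> i < m \<Longrightarrow> R g $$ (i, j) = 0"
  shows "representation G r (\<lambda>g. mat r r (\<lambda>(i, j). R g $$ (i, j)))" (is "representation G r ?A")
    and "representation G (m - r) (\<lambda>g. mat (m - r) (m - r) (\<lambda>(i, j). R g $$ (r + i, r + j)))"
      (is "representation G _ ?D")
    and "g \<in> carrier G \<Longrightarrow> mat_trace (R g) =
      mat_trace (mat r r (\<lambda>(i, j). R g $$ (i, j))) +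
      mat_trace (mat (m - r) (m - r) (\<lambda>(i, j). R g $$ (r + i, r + j)))"
proof -
  note R = representationD[OF G rep]
  have split: "(\<Sum>k<m. f k) = (\<Sum>k<r. f k) + (\<Sum>k<m - r. f (r + k))" for f :: "nat \<Rightarrow> complex"
  proof -
    have "{..<m} = {..<r} \<union> {r..<m}" using r by auto
    then have "(\<Sum>k<m. f k) = (\<Sum>k<r. f k) + (\<Sum>k\<in>{r..<m}. f k)"
      by (simp add: sum.union_disjoint ivl_disj_int)
    also have "(\<Sum>k\<in>{r..<m}. f k) = (\<Sum>k<m - r. f (r + k))"
      by (rule sum.reindex_bij_witness[of _ "\<lambda>k. r + k" "\<lambda>k. k - r"]) auto
    finally show ?thesis .
  qed
  have mult: "R (g \<otimes>\<^bsub>G\<^esub> h) $$ (i, j) =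
      (\<Sum>k<r. R g $$ (i, k) * R h $$ (k, j)) + (\<Sum>k<m - r. R g $$ (i, r + k) * R h $$ (r + k, j))"
    if "g \<in> carrier G" "h \<in> carrier G" "i < m" "j < m" for g h i j
    using that by (simp only: R(2) mult_mat_entry[OF R(1) R(1)] split)
  show "representation G r ?A"
  proof (rule representationI[OF G])
    show "?A \<one>\<^bsub>G\<^esub> = 1\<^sub>m r" using r by (intro eq_matI) (auto simp: R(3))
    fix g h assume g: "g \<in> carrier G" and h: "h \<in> carrier G"
    show "?A (g \<otimes>\<^bsub>G\<^esub> h) = ?A g * ?A h"
    proof (rule eq_matI)
      fix i j assume "i < dim_row (?A g * ?A h)" "j < dim_col (?A g * ?A h)"
      then have ij: "i < r" "j < r" by auto
      have "(?A g * ?A h) $$ (i, j) = (\<Sum>k<r. ?A g $$ (i, k) * ?A h $$ (k, j))"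
        by (rule mult_mat_entry) (use ij in auto)
      also have "\<dots> = R (g \<otimes>\<^bsub>G\<^esub> h) $$ (i, j)"
        using ij r zero[OF h, of j] by (simp add: mult[OF g h])
      finally show "?A (g \<otimes>\<^bsub>G\<^esub> h) $$ (i, j) = (?A g * ?A h) $$ (i, j)" using ij by simp
    qed auto
  qed auto
  show "representation G (m - r) ?D"
  proof (rule representationI[OF G])
    show "?D \<one>\<^bsub>G\<^esub> = 1\<^sub>m (m - r)" using r by (intro eq_matI) (auto simp: R(3))
    fix g h assume g: "g \<in> carrier G" and h: "h \<in> carrier G"
    show "?D (g \<otimes>\<^bsub>G\<^esub> h) = ?D g * ?D h"
    proof (rule eq_matI)
      fix i j assume "i < dim_row (?D g * ?D h)" "j < dim_col (?D g * ?D h)"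
      then have ij: "i < m - r" "j < m - r" by auto
      have "(?D g * ?D h) $$ (i, j) = (\<Sum>k<m - r. ?D g $$ (i, k) * ?D h $$ (k, j))"
        by (rule mult_mat_entry) (use ij in auto)
      also have "\<dots> = R (g \<otimes>\<^bsub>G\<^esub> h) $$ (r + i, r + j)"
        using ij r zero[OF g, of _ "r + i"] by (simp add: mult[OF g h])
      finally show "?D (g \<otimes>\<^bsub>G\<^esub> h) $$ (i, j) = (?D g * ?D h) $$ (i, j)" using ij by simp
    qed auto
  qed auto
  show "mat_trace (R g) = mat_trace (?A g) + mat_trace (?D g)" if "g \<in> carrier G"
    using mat_trace_carrier[OF R(1)[OF that]] by (simp add: split mat_trace_def)
qed

text \<open>
  In a basis adapted to an invariant subspace the representation is block triangular, and its trace is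
  the sum of the traces of the diagonal blocks, which are representations of smaller degree.
\<close>

lemma character_sum_of_irreducibles:
  assumes G: "group G" and rep: "representation G m \<rho>"
  shows "\<exists>L. set L \<subseteq> irreducible_characters G \<and>
    (\<forall>g\<in>carrier G. mat_trace (\<rho> g) = (\<Sum>\<chi>\<leftarrow>L. \<chi> g))"
  using rep
proof (induction m arbitrary: \<rho> rule: less_induct)
  case (less m)
  note \<rho> = representationD[OF G less.prems]
  consider "m = 0" | "irreducible_representation G m \<rho>" 
    | W where "m > 0" "invariant_subspace G m \<rho> W" "W \<noteq> {0\<^sub>v m}" "W \<noteq> carrier_vec m"
    using less.prems by (auto simp: irreducible_representation_def)
  then show ?case
  proof cases
    case 1
    then have "mat_trace (\<rho> g) = 0" if "g \<in> carrier G" for g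
      using mat_trace_carrier[OF \<rho>(1)[OF that]] by simp
    then show ?thesis by (intro exI[of _ "[]"]) auto
  next
    case 2
    then have "afforded_character G \<rho> \<in> irreducible_characters G"
      by (auto simp: irreducible_characters_def)
    then show ?thesis
      by (intro exI[of _ "[afforded_character G \<rho>]"]) (auto simp: afforded_character_def)
  next
    case 3
    have W: "VectorSpace.subspace class_ring W (module_vec TYPE(complex) m)"
      and inv: "\<And>g w. g \<in> carrier G \<Longrightarrow> w \<in> W \<Longrightarrow> \<rho> g *\<^sub>v w \<in> W"
      using 3 by (auto simp: invariant_subspace_def)
    obtain P Q r where PQ: "P \<in> carrier_mat m m" "Q \<in> carrier_mat m m" "P * Q = 1\<^sub>m m" "Q * P = 1\<^sub>m m"
      and r: "0 < r" "r < m" and cP: "\<And>j. j < r \<Longrightarrow> col P j \<in> W"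
      and Q0: "\<And>w i. w \<in> W \<Longrightarrow> r \<le> i \<Longrightarrow> i < m \<Longrightarrow> (Q *\<^sub>v w) $ i = 0"
      using adapted_basis[OF W 3(3,4)] by blast
    let ?R = "\<lambda>g. Q * \<rho> g * P"
    have repR: "representation G m ?R" by (rule representation_conjugate[OF G less.prems PQ])
    have zero: "?R g $$ (i, j) = 0" if "g \<in> carrier G" "j < r" "r \<le> i" "i < m" for g i j
    proof -
      note g = \<rho>(1)[OF that(1)]
      have j: "j < m" using that by simp
      have "col (?R g) j = (Q * \<rho> g) *\<^sub>v col P j"
        by (rule col_mult2[of _ m m _ m]) (use g PQ j in auto)
      also have "\<dots> = Q *\<^sub>v (\<rho> g *\<^sub>v col P j)"
        by (rule assoc_mult_mat_vec[of _ m m _ m]) (use g PQ j in auto)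
      finally have "col (?R g) j $ i = 0" using Q0[OF inv[OF that(1) cP[OF that(2)]] that(3,4)] by simp
      then show ?thesis using that j g PQ by simp
    qed
    note blocks = block_triangular_representation[OF G repR less_imp_le[OF r(2)] zero]
    obtain L1 where L1: "set L1 \<subseteq> irreducible_characters G"
      "\<forall>g\<in>carrier G. mat_trace (mat r r (\<lambda>(i, j). ?R g $$ (i, j))) = (\<Sum>\<chi>\<leftarrow>L1. \<chi> g)"
      using less.IH[OF r(2) blocks(1)] by blast
    obtain L2 where L2: "set L2 \<subseteq> irreducible_characters G"
      "\<forall>g\<in>carrier G. mat_trace (mat (m - r) (m - r) (\<lambda>(i, j). ?R g $$ (r + i, r + j))) = (\<Sum>\<chi>\<leftarrow>L2. \<chi> g)"
      using less.IH[OF _ blocks(2)] r by auto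
    have "mat_trace (\<rho> g) = (\<Sum>\<chi>\<leftarrow>L1 @ L2. \<chi> g)" if "g \<in> carrier G" for g
    proof -
      have "mat_trace (\<rho> g) = mat_trace (?R g)"
        using mat_trace_conjugate[OF \<rho>(1)[OF that] PQ(1,2,3)] by simp
      also have "\<dots> = (\<Sum>\<chi>\<leftarrow>L1. \<chi> g) + (\<Sum>\<chi>\<leftarrow>L2. \<chi> g)"
        by (subst blocks(3)[OF _ _ _ _ that]) (use L1 L2 that in auto)
      finally show ?thesis by simp
    qed
    then show ?thesis using L1 L2 by (intro exI[of _ "L1 @ L2"]) auto
  qed
qed

text \<open>
  The character of the regular representation is \<open>n\<close> times the indicator of the identity. Through
  this identity the irreducible characters are seen to be complete.
\<close>

lemma regular_character_sum_of_irreducibles: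
  assumes G: "group G" and fin: "finite (carrier G)"
  obtains L where "set L \<subseteq> irreducible_characters G"
    "\<And>g. g \<in> carrier G \<Longrightarrow> (\<Sum>\<chi>\<leftarrow>L. \<chi> g) = (if g = \<one>\<^bsub>G\<^esub> then of_nat (Coset.order G) else 0)"
proof -
  interpret group G by fact
  define n where "n = Coset.order G"
  obtain e where e: "bij_betw e {..<n} (carrier G)"
    using ex_bij_betw_nat_finite[OF fin] by (auto simp: n_def Coset.order_def atLeast0LessThan)
  have eG: "e i \<in> carrier G" if "i < n" for i using e that by (auto simp: bij_betw_def)
  have einj: "e i = e j \<longleftrightarrow> i = j" if "i < n" "j < n" for i j
    using e that by (auto simp: bij_betw_def inj_on_def)
  define \<rho> :: "'a \<Rightarrow> complex mat" where
    "\<rho> g = mat n n (\<lambda>(i, j). if e i = g \<otimes>\<^bsub>G\<^esub> e j then 1 else 0)" for g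
  have "representation G n \<rho>"
  proof (rule representationI[OF G])
    show "\<rho> \<one>\<^bsub>G\<^esub> = 1\<^sub>m n" by (rule eq_matI) (auto simp: \<rho>_def eG einj)
    fix g h assume g: "g \<in> carrier G" and h: "h \<in> carrier G"
    show "\<rho> (g \<otimes>\<^bsub>G\<^esub> h) = \<rho> g * \<rho> h"
    proof (rule eq_matI)
      fix i j assume "i < dim_row (\<rho> g * \<rho> h)" "j < dim_col (\<rho> g * \<rho> h)"
      then have ij: "i < n" "j < n" by (auto simp: \<rho>_def)
      have "h \<otimes>\<^bsub>G\<^esub> e j \<in> e ` {..<n}" using e h eG[OF ij(2)] by (auto simp: bij_betw_def)
      then obtain k where k: "k < n" "h \<otimes>\<^bsub>G\<^esub> e j = e k" by auto
      have "(\<rho> g * \<rho> h) $$ (i, j) = (\<Sum>l<n. \<rho> g $$ (i, l) * \<rho> h $$ (l, j))"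
        by (rule mult_mat_entry) (use ij in \<open>auto simp: \<rho>_def\<close>)
      also have "\<dots> = (\<Sum>l<n. if l = k then \<rho> g $$ (i, k) else 0)"
        by (rule sum.cong[OF refl]) (use ij k einj in \<open>auto simp: \<rho>_def\<close>)
      also have "\<dots> = \<rho> g $$ (i, k)" using k by simp
      also have "\<dots> = \<rho> (g \<otimes>\<^bsub>G\<^esub> h) $$ (i, j)"
        using ij k g h eG[OF ij(2)] by (simp add: \<rho>_def m_assoc)
      finally show "\<rho> (g \<otimes>\<^bsub>G\<^esub> h) $$ (i, j) = (\<rho> g * \<rho> h) $$ (i, j)" by simp
    qed (auto simp: \<rho>_def)
  qed (auto simp: \<rho>_def)
  then obtain L where L: "set L \<subseteq> irreducible_characters G"
    "\<And>g. g \<in> carrier G \<Longrightarrow> mat_trace (\<rho> g) = (\<Sum>\<chi>\<leftarrow>L. \<chi> g)"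
    using character_sum_of_irreducibles[OF G] by blast
  have "mat_trace (\<rho> g) = (if g = \<one>\<^bsub>G\<^esub> then of_nat n else 0)" if g: "g \<in> carrier G" for g
  proof -
    have "e i = g \<otimes>\<^bsub>G\<^esub> e i \<longleftrightarrow> g = \<one>\<^bsub>G\<^esub>" if "i < n" for i
      using g eG[OF that] by (metis l_one right_cancel one_closed)
    then show ?thesis by (simp add: mat_trace_def \<rho>_def)
  qed
  then show thesis using that[OF L(1)] L(2) by (simp add: n_def)
qed

section \<open>An intrinsic description of irreducible characters\<close>

lemma sum_list_count_list:
  fixes F :: "'a \<Rightarrow> complex"
  assumes "finite A" "set xs \<subseteq> A"
  shows "(\<Sum>x\<leftarrow>xs. F x) = (\<Sum>x\<in>A. of_nat (count_list xs x) * F x)"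
  using assms(2)
proof (induction xs)
  case (Cons y ys)
  have "(\<Sum>x\<in>A. of_nat (count_list (y # ys) x) * F x) =
      (\<Sum>x\<in>A. (if x = y then F y else 0) + of_nat (count_list ys x) * F x)"
    by (rule sum.cong) (auto simp: algebra_simps)
  then show ?case using Cons assms(1) by (simp add: sum.distrib)
qed simp

locale finite_group = group G for G :: "('a, 'b) monoid_scheme" (structure) +
  assumes fin: "finite (carrier G)"
begin

abbreviation n :: nat where "n \<equiv> Coset.order G"

lemma order_pos: "n > 0"
  using fin by (simp add: order_gt_0_iff_finite)

text \<open>
  This is \<open>n\<close> times the usual inner product, with \<open>h (inv g)\<close> in place of the complex conjugate of \<open>h g\<close>,
  so that it is compatible with Galois conjugation of the values.
\<close>

definition pairing :: "('a \<Rightarrow> complex) \<Rightarrow> ('a \<Rightarrow> complex) \<Rightarrow> complex" where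
  "pairing f h = (\<Sum>g\<in>carrier G. f g * h (inv g))"

text \<open>
  The third condition says that \<open>f / f(1)\<close> extends to a homomorphism from the centre of the group algebra
  to the complex numbers, expressed on elements instead of class sums. It is invariant under scaling of
  \<open>f\<close>; the norm condition together with the positive degree removes this freedom.
\<close>

definition character_equations :: "('a \<Rightarrow> complex) \<Rightarrow> bool" where
  "character_equations f \<longleftrightarrow> f \<in> extensional (carrier G) \<and> (\<exists>d>0. f \<one> = of_nat d) \<and>
     (\<forall>g\<in>carrier G. \<forall>h\<in>carrier G.
        of_nat n * (f g * f h) = f \<one> * (\<Sum>t\<in>carrier G. f (g \<otimes> (t \<otimes> h \<otimes> inv t)))) \<and>
     pairing f f = of_nat n"

lemma character_equationsD:
  assumes "character_equations f"
  shows "f \<in> extensional (carrier G)" "f \<one> \<noteq> 0" "\<exists>d>0. f \<one> = of_nat d"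
    "g \<in> carrier G \<Longrightarrow> h \<in> carrier G \<Longrightarrow> 
      of_nat n * (f g * f h) = f \<one> * (\<Sum>t\<in>carrier G. f (g \<otimes> (t \<otimes> h \<otimes> inv t)))"
    "pairing f f = of_nat n"
  using assms by (auto simp: character_equations_def)

lemma sum_inv: "(\<Sum>g\<in>carrier G. F (inv g)) = (\<Sum>g\<in>carrier G. F g)"
  for F :: "'a \<Rightarrow> complex"
  by (rule sum.reindex_bij_witness[of _ "m_inv G" "m_inv G"]) auto

lemma sum_translate_right: "s \<in> carrier G \<Longrightarrow> (\<Sum>t\<in>carrier G. F (t \<otimes> s)) = (\<Sum>t\<in>carrier G. F t)"
  for F :: "'a \<Rightarrow> complex"
  by (rule sum.reindex_bij_witness[of _ "\<lambda>t. t \<otimes> inv s" "\<lambda>t. t \<otimes> s"]) (auto simp: m_assoc)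

lemma sum_conjugate: "s \<in> carrier G \<Longrightarrow> (\<Sum>t\<in>carrier G. F (s \<otimes> t \<otimes> inv s)) = (\<Sum>t\<in>carrier G. F t)"
  for F :: "'a \<Rightarrow> complex"
proof (rule sum.reindex_bij_witness[of _ "\<lambda>t. inv s \<otimes> t \<otimes> s" "\<lambda>t. s \<otimes> t \<otimes> inv s"])
  fix a assume s: "s \<in> carrier G" and a: "a \<in> carrier G"
  have "inv s \<otimes> (s \<otimes> x) = x" "s \<otimes> (inv s \<otimes> x) = x" if "x \<in> carrier G" for x
    using s that by (simp_all add: m_assoc[symmetric])
  then show "inv s \<otimes> (s \<otimes> a \<otimes> inv s) \<otimes> s = a" "s \<otimes> (inv s \<otimes> a \<otimes> s) \<otimes> inv s = a"
    using s a by (simp_all add: m_assoc)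
qed auto

lemma conjugate_conjugate:
  "s \<in> carrier G \<Longrightarrow> t \<in> carrier G \<Longrightarrow> h \<in> carrier G \<Longrightarrow>
    s \<otimes> (t \<otimes> h \<otimes> inv t) \<otimes> inv s = (s \<otimes> t) \<otimes> h \<otimes> inv (s \<otimes> t)"
  by (simp add: inv_mult_group m_assoc)

lemma conjugate_inv:
  "t \<in> carrier G \<Longrightarrow> h \<in> carrier G \<Longrightarrow> inv (t \<otimes> h \<otimes> inv t) = t \<otimes> inv h \<otimes> inv t"
  by (simp add: inv_mult_group m_assoc)

text \<open>
  For \<open>g = 1\<close> the multiplicativity formula exhibits \<open>f\<close> as its own average over conjugates.
\<close>

lemma class_function:
  assumes f: "character_equations f" and t: "t \<in> carrier G" and h: "h \<in> carrier G"
  shows "f (t \<otimes> h \<otimes> inv t) = f h"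
proof -
  note fD = character_equationsD[OF f]
  have avg: "of_nat n * f x = (\<Sum>s\<in>carrier G. f (s \<otimes> x \<otimes> inv s))" if x: "x \<in> carrier G" for x
  proof -
    have "of_nat n * (f \<one> * f x) = f \<one> * (\<Sum>s\<in>carrier G. f (\<one> \<otimes> (s \<otimes> x \<otimes> inv s)))"
      by (rule fD(4)) (use x in auto)
    also have "(\<Sum>s\<in>carrier G. f (\<one> \<otimes> (s \<otimes> x \<otimes> inv s))) = (\<Sum>s\<in>carrier G. f (s \<otimes> x \<otimes> inv s))"
      by (rule sum.cong[OF refl]) (use x in auto)
    finally show ?thesis using fD(2) by simp
  qed
  have "of_nat n * f (t \<otimes> h \<otimes> inv t) = (\<Sum>s\<in>carrier G. f ((s \<otimes> t) \<otimes> h \<otimes> inv (s \<otimes> t)))"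
    using t h by (subst avg) (auto simp: conjugate_conjugate intro!: sum.cong)
  also have "\<dots> = (\<Sum>s\<in>carrier G. f (s \<otimes> h \<otimes> inv s))"
    by (rule sum_translate_right[OF t])
  also have "\<dots> = of_nat n * f h" by (rule avg[OF h, symmetric])
  finally show ?thesis using order_pos by simp
qed

lemma pairing_commute: "pairing f h = pairing h f"
  unfolding pairing_def
  by (subst sum_inv[symmetric]) (auto simp: mult.commute intro!: sum.cong)

text \<open>
  A class function convolved with \<open>f'\<close> is a multiple of \<open>f'\<close>: average the summand over conjugates of \<open>g\<close>
  and apply the multiplicativity formula.
\<close>

lemma convolution:
  assumes f: "character_equations f" and f': "character_equations f'" and h: "h \<in> carrier G"
  shows "f' h * pairing f f' = f' \<one> * (\<Sum>g\<in>carrier G. f g * f' (h \<otimes> inv g))"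
proof -
  have "of_nat n * (f' h * pairing f f') = (\<Sum>g\<in>carrier G. f g * (of_nat n * (f' h * f' (inv g))))"
    unfolding pairing_def sum_distrib_left by (simp add: mult_ac)
  also have "\<dots> = (\<Sum>g\<in>carrier G. f g * (f' \<one> * (\<Sum>t\<in>carrier G. f' (h \<otimes> (t \<otimes> inv g \<otimes> inv t)))))"
    by (intro sum.cong refl) (simp add: character_equationsD(4)[OF f' h])
  also have "\<dots> = f' \<one> * (\<Sum>t\<in>carrier G. \<Sum>g\<in>carrier G. f g * f' (h \<otimes> (t \<otimes> inv g \<otimes> inv t)))"
    unfolding sum_distrib_left by (subst sum.swap) (simp add: mult_ac)
  also have "(\<Sum>t\<in>carrier G. \<Sum>g\<in>carrier G. f g * f' (h \<otimes> (t \<otimes> inv g \<otimes> inv t))) =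
      (\<Sum>t\<in>carrier G. \<Sum>g\<in>carrier G. f g * f' (h \<otimes> inv g))"
  proof (rule sum.cong[OF refl])
    fix t assume t: "t \<in> carrier G"
    have "(\<Sum>g\<in>carrier G. f g * f' (h \<otimes> (t \<otimes> inv g \<otimes> inv t))) =
      (\<Sum>g\<in>carrier G. f (t \<otimes> g \<otimes> inv t) * f' (h \<otimes> inv (t \<otimes> g \<otimes> inv t)))"
      using t h by (intro sum.cong refl) (simp add: class_function[OF f] conjugate_inv)
    then show "(\<Sum>g\<in>carrier G. f g * f' (h \<otimes> (t \<otimes> inv g \<otimes> inv t))) = (\<Sum>g\<in>carrier G. f g * f' (h \<otimes> inv g))"
      using sum_conjugate[OF t, of "\<lambda>g. f g * f' (h \<otimes> inv g)"] by simp
  qed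
  also have "\<dots> = of_nat n * (\<Sum>g\<in>carrier G. f g * f' (h \<otimes> inv g))"
    by (simp add: Coset.order_def)
  finally show ?thesis using order_pos by simp
qed

lemma convolution_commute:
  assumes f: "character_equations f" and f': "character_equations f'" and h: "h \<in> carrier G"
  shows "(\<Sum>g\<in>carrier G. f g * f' (h \<otimes> inv g)) = (\<Sum>g\<in>carrier G. f' g * f (h \<otimes> inv g))"
proof (rule sum.reindex_bij_witness[of _ "\<lambda>g. inv g \<otimes> h" "\<lambda>g. h \<otimes> inv g"])
  fix g assume g: "g \<in> carrier G"
  have "f (h \<otimes> inv (h \<otimes> inv g)) = f (h \<otimes> g \<otimes> inv h)"
    using g h by (simp add: inv_mult_group m_assoc)
  then have "f (h \<otimes> inv (h \<otimes> inv g)) = f g" using class_function[OF f h g] by simp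
  then show "f' (h \<otimes> inv g) * f (h \<otimes> inv (h \<otimes> inv g)) = f g * f' (h \<otimes> inv g)" by (simp add: mult.commute)
qed (use h in \<open>auto simp: inv_mult_group m_assoc\<close>, simp_all add: h m_assoc[symmetric])

text \<open>
  By the previous two lemmas the convolution of \<open>f\<close> and \<open>f'\<close> is a multiple of both, with the pairing as
  the factor. So if the pairing is not zero, \<open>f\<close> and \<open>f'\<close> are proportional; comparing norms, the
  degrees, which are positive integers, agree.
\<close>

lemma character_equations_orthogonal:
  assumes f: "character_equations f" and f': "character_equations f'" and nz: "pairing f f' \<noteq> 0"
  shows "f = f'"
proof -
  note fD = character_equationsD[OF f] and fD' = character_equationsD[OF f']
  have ratio: "f' h * f \<one> = f h * f' \<one>" if h: "h \<in> carrier G" for h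
  proof -
    define S where "S = (\<Sum>g\<in>carrier G. f g * f' (h \<otimes> inv g))"
    have S: "f' h * pairing f f' = f' \<one> * S" "f h * pairing f f' = f \<one> * S"
      using convolution[OF f f' h] convolution[OF f' f h] convolution_commute[OF f f' h]
      by (simp_all add: S_def pairing_commute)
    have "pairing f f' * (f' h * f \<one>) = (f' h * pairing f f') * f \<one>" by (simp only: mult_ac)
    also have "\<dots> = (f h * pairing f f') * f' \<one>" unfolding S by (simp only: mult_ac)
    also have "\<dots> = pairing f f' * (f h * f' \<one>)" by (simp only: mult_ac)
    finally show ?thesis using nz by simp
  qed
  obtain d d' where d: "f \<one> = of_nat d" "f' \<one> = of_nat d'" "d > 0" "d' > 0" using fD(3) fD'(3) by blast
  have "of_nat n * (f \<one>)\<^sup>2 = (\<Sum>g\<in>carrier G. (f' g * f \<one>) * (f' (inv g) * f \<one>))"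
    unfolding fD'(5)[symmetric] pairing_def sum_distrib_right by (simp add: power2_eq_square mult_ac)
  also have "\<dots> = (\<Sum>g\<in>carrier G. (f g * f' \<one>) * (f (inv g) * f' \<one>))"
    by (intro sum.cong refl) (simp add: ratio)
  also have "\<dots> = of_nat n * (f' \<one>)\<^sup>2"
    unfolding fD(5)[symmetric] pairing_def sum_distrib_right by (simp add: power2_eq_square mult_ac)
  finally have "(f \<one>)\<^sup>2 = (f' \<one>)\<^sup>2" using order_pos by simp
  then have "(of_nat (d\<^sup>2) :: complex) = of_nat (d'\<^sup>2)" using d by simp
  then have "d\<^sup>2 = d'\<^sup>2" by (simp only: of_nat_eq_iff)
  then have "f \<one> = f' \<one>" using d by simp
  then have "f h = f' h" if "h \<in> carrier G" for h using ratio[OF that] fD(2) by simp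
  then show ?thesis using fD(1) fD'(1) by (rule extensionalityI[rotated 2])
qed

text \<open>
  Multiply the average of \<open>\<rho> h\<close> by \<open>\<rho> g\<close> and take traces to obtain the multiplicativity formula. The
  averages of the matrix units give the orthogonality relations of matrix entries, and from them the
  norm.
\<close>

lemma irreducible_character_equations:
  assumes "\<chi> \<in> irreducible_characters G"
  shows "character_equations \<chi>"
proof -
  obtain d \<rho> where \<chi>: "\<chi> = afforded_character G \<rho>" and irr: "irreducible_representation G d \<rho>"
    using assms by (auto simp: irreducible_characters_def)
  have rep: "representation G d \<rho>" and d: "d > 0" 
    using irr by (auto simp: irreducible_representation_def)
  note \<rho> = representationD[OF group_axioms rep]
  have val: "\<chi> g = mat_trace (\<rho> g)" if "g \<in> carrier G" for g
    using that by (simp add: \<chi> afforded_character_def)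
  have one: "\<chi> \<one> = of_nat d" by (simp add: val \<rho>(3) mat_trace_def)
  note avg = irreducible_average[OF group_axioms irr]
  have "of_nat n * (\<chi> g * \<chi> h) = \<chi> \<one> * (\<Sum>t\<in>carrier G. \<chi> (g \<otimes> (t \<otimes> h \<otimes> inv t)))"
    if g: "g \<in> carrier G" and h: "h \<in> carrier G" for g h
  proof -
    have car: "\<rho> t * \<rho> h * \<rho> (inv t) \<in> carrier_mat d d" if "t \<in> carrier G" for t
      using \<rho>(1)[OF that] \<rho>(1)[OF h] \<rho>(1)[OF inv_closed[OF that]] by auto
    have "(\<Sum>t\<in>carrier G. \<chi> (g \<otimes> (t \<otimes> h \<otimes> inv t))) =
        (\<Sum>t\<in>carrier G. mat_trace (\<rho> g * (\<rho> t * \<rho> h * \<rho> (inv t))))"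
      using g h by (intro sum.cong refl) (simp add: val \<rho>(2))
    also have "\<dots> = mat_trace (mat_sum d (\<lambda>t. \<rho> g * (\<rho> t * \<rho> h * \<rho> (inv t))) (carrier G))"
      by (rule mat_trace_mat_sum[symmetric]) (use \<rho>(1)[OF g] car in auto)
    also have "\<dots> = mat_trace (\<rho> g * mat_sum d (\<lambda>t. \<rho> t * \<rho> h * \<rho> (inv t)) (carrier G))"
      by (subst mat_sum_mult_left[OF \<rho>(1)[OF g] car]) auto
    also have "\<dots> = of_nat n * \<chi> h / of_nat d * \<chi> g"
    proof -
      have "\<rho> g * ((of_nat n * mat_trace (\<rho> h) / of_nat d) \<cdot>\<^sub>m 1\<^sub>m d) =
          (of_nat n * mat_trace (\<rho> h) / of_nat d) \<cdot>\<^sub>m \<rho> g"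
        using mult_smult_distrib[OF \<rho>(1)[OF g] one_carrier_mat, of "of_nat n * mat_trace (\<rho> h) / of_nat d"]
          \<rho>(1)[OF g] by simp
      then show ?thesis
        unfolding avg[OF \<rho>(1)[OF h]] val[OF g] val[OF h] by (simp add: mat_trace_smult[OF \<rho>(1)[OF g]])
    qed
    finally show ?thesis using d by (simp add: one field_simps)
  qed
  moreover have "pairing \<chi> \<chi> = of_nat n"
  proof -
    define X :: "nat \<Rightarrow> nat \<Rightarrow> complex mat" where
      "X i k = mat d d (\<lambda>(a, b). if a = i \<and> b = k then 1 else 0)" for i k
    have X: "X i k \<in> carrier_mat d d" for i k by (simp add: X_def)
    have entry: "(\<rho> t * X i k * \<rho> (inv t)) $$ (i, k) = \<rho> t $$ (i, i) * \<rho> (inv t) $$ (k, k)"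
      if t: "t \<in> carrier G" and ik: "i < d" "k < d" for t i k
    proof -
      note t1 = \<rho>(1)[OF t] and t2 = \<rho>(1)[OF inv_closed[OF t]]
      have "(\<rho> t * X i k) $$ (i, b) = (if b = k then \<rho> t $$ (i, i) else 0)" if b: "b < d" for b
      proof -
        have "(\<rho> t * X i k) $$ (i, b) = (\<Sum>l<d. \<rho> t $$ (i, l) * X i k $$ (l, b))"
          by (rule mult_mat_entry[OF t1 X ik(1) b])
        also have "\<dots> = (\<Sum>l<d. if l = i then (if b = k then \<rho> t $$ (i, i) else 0) else 0)"
          by (rule sum.cong[OF refl]) (use b in \<open>auto simp: X_def\<close>)
        finally show ?thesis using ik by simp
      qed
      moreover have "(\<rho> t * X i k * \<rho> (inv t)) $$ (i, k) = (\<Sum>l<d. (\<rho> t * X i k) $$ (i, l) * \<rho> (inv t) $$ (l, k))"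
        by (rule mult_mat_entry[OF mult_carrier_mat[OF t1 X] t2 ik])
      ultimately have "(\<rho> t * X i k * \<rho> (inv t)) $$ (i, k) = 
          (\<Sum>l<d. if l = k then \<rho> t $$ (i, i) * \<rho> (inv t) $$ (k, k) else 0)"
        by (simp only:) (intro sum.cong refl, simp)
      then show ?thesis using ik by simp
    qed
    have sum1: "(\<Sum>t\<in>carrier G. \<rho> t $$ (i, i) * \<rho> (inv t) $$ (k, k)) = 
        (if i = k then of_nat n / of_nat d else 0)" if ik: "i < d" "k < d" for i k
    proof -
      have "(\<Sum>t\<in>carrier G. \<rho> t $$ (i, i) * \<rho> (inv t) $$ (k, k)) = 
          mat_sum d (\<lambda>t. \<rho> t * X i k * \<rho> (inv t)) (carrier G) $$ (i, k)"
        unfolding mat_sum_def using ik entry[OF _ ik] by (simp del: index_mult_mat)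
      also have "\<dots> = (if i = k then of_nat n * mat_trace (X i k) / of_nat d else 0)"
        unfolding avg[OF X] using ik by simp
      also have "mat_trace (X i k) = (if i = k then 1 else 0)"
        using ik by (auto simp: mat_trace_def X_def intro: sum.neutral)
      finally show ?thesis by simp
    qed
    have "pairing \<chi> \<chi> = (\<Sum>t\<in>carrier G. \<Sum>i<d. \<Sum>k<d. \<rho> t $$ (i, i) * \<rho> (inv t) $$ (k, k))"
      unfolding pairing_def
      by (rule sum.cong[OF refl])
        (simp add: val mat_trace_carrier[OF \<rho>(1)] sum_product)
    also have "\<dots> = (\<Sum>i<d. \<Sum>k<d. \<Sum>t\<in>carrier G. \<rho> t $$ (i, i) * \<rho> (inv t) $$ (k, k))"
      by (subst sum.swap, intro sum.cong refl, rule sum.swap)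
    also have "\<dots> = (\<Sum>i<d. \<Sum>k<d. if i = k then of_nat n / of_nat d else 0)"
      by (intro sum.cong refl) (simp add: sum1)
    also have "\<dots> = of_nat n" using d by simp
    finally show ?thesis .
  qed
  ultimately show ?thesis
    unfolding character_equations_def using d one
    by (auto simp: \<chi> afforded_character_def)
qed

lemma regular_character:
  obtains L where "set L \<subseteq> irreducible_characters G"
    "\<And>g. g \<in> carrier G \<Longrightarrow> (\<Sum>\<chi>\<leftarrow>L. \<chi> g) = (if g = \<one> then of_nat n else 0)"
  using regular_character_sum_of_irreducibles[OF group_axioms fin] by blast

lemma pairing_regular:
  assumes L: "\<And>g. g \<in> carrier G \<Longrightarrow> (\<Sum>\<chi>\<leftarrow>L. \<chi> g) = (if g = \<one> then of_nat n else 0)"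
  shows "(\<Sum>\<chi>\<leftarrow>L. pairing f \<chi>) = of_nat n * f \<one>"
proof -
  have "(\<Sum>\<chi>\<leftarrow>L. pairing f \<chi>) = (\<Sum>g\<in>carrier G. f g * (\<Sum>\<chi>\<leftarrow>L. \<chi> (inv g)))"
    unfolding pairing_def by (induction L) (simp_all add: sum.distrib algebra_simps)
  also have "\<dots> = (\<Sum>g\<in>carrier G. if g = \<one> then f \<one> * of_nat n else 0)"
    by (rule sum.cong[OF refl]) (auto simp: L)
  also have "\<dots> = of_nat n * f \<one>" using fin by simp
  finally show ?thesis .
qed

text \<open>
  A solution \<open>f\<close> of the equations pairs with the regular character to \<open>n f(1)\<close>, which is not zero; so it
  pairs non-trivially with an irreducible constituent \<open>\<chi>\<close>, and orthogonality gives \<open>f = \<chi>\<close>.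
\<close>

theorem irreducible_characters_eq: "irreducible_characters G = {f. character_equations f}"
proof (intro equalityI subsetI)
  fix f assume "f \<in> {f. character_equations f}"
  then have f: "character_equations f" by simp
  obtain L where L: "set L \<subseteq> irreducible_characters G"
    "\<And>g. g \<in> carrier G \<Longrightarrow> (\<Sum>\<chi>\<leftarrow>L. \<chi> g) = (if g = \<one> then of_nat n else 0)"
    using regular_character by blast
  have "(\<Sum>\<chi>\<leftarrow>L. pairing f \<chi>) \<noteq> 0"
    using pairing_regular[OF L(2)] order_pos character_equationsD(2)[OF f] by simp
  then obtain \<chi> where \<chi>: "\<chi> \<in> set L" "pairing f \<chi> \<noteq> 0"
    by (metis sum_list_0 map_cong)
  then have "f = \<chi>" using L(1) irreducible_character_equations
    by (intro character_equations_orthogonal[OF f]) auto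
  then show "f \<in> irreducible_characters G" using \<chi> L(1) by auto
qed (use irreducible_character_equations in auto)

lemma pairing_irreducible:
  assumes "f \<in> irreducible_characters G" "f' \<in> irreducible_characters G"
  shows "pairing f f' = (if f = f' then of_nat n else 0)"
  using assms character_equations_orthogonal character_equationsD(5)
  unfolding irreducible_characters_eq by auto

lemma finite_irreducible_characters: "finite (irreducible_characters G)"
  and regular_character_multiplicities: "g \<in> carrier G \<Longrightarrow>
    (\<Sum>\<chi>\<in>irreducible_characters G. \<chi> \<one> * \<chi> g) = (if g = \<one> then of_nat n else 0)"
proof -
  obtain L where L: "set L \<subseteq> irreducible_characters G"
    "\<And>g. g \<in> carrier G \<Longrightarrow> (\<Sum>\<chi>\<leftarrow>L. \<chi> g) = (if g = \<one> then of_nat n else 0)"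
    using regular_character by blast
  have count: "of_nat (count_list L f) = f \<one>" if f: "f \<in> irreducible_characters G" for f
  proof -
    have "(\<Sum>\<chi>\<leftarrow>L. pairing f \<chi>) = (\<Sum>\<chi>\<leftarrow>L. if \<chi> = f then of_nat n else 0)"
      by (intro arg_cong[of _ _ sum_list] map_cong refl)
        (use pairing_irreducible f L(1) in auto)
    also have "\<dots> = of_nat n * of_nat (count_list L f)" by (induction L) (auto simp: algebra_simps)
    finally show ?thesis using pairing_regular[OF L(2), of f] order_pos by simp
  qed
  have sub: "irreducible_characters G \<subseteq> set L"
  proof
    fix f assume f: "f \<in> irreducible_characters G"
    then have "f \<one> \<noteq> 0" using irreducible_character_equations character_equationsD(2) by blast
    then have "count_list L f \<noteq> 0" unfolding count[OF f, symmetric] of_nat_eq_0_iff .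
    then show "f \<in> set L" by (rule contrapos_np) (rule count_notin)
  qed
  then have eq: "irreducible_characters G = set L" using L(1) by auto
  show "finite (irreducible_characters G)" unfolding eq by simp
  assume g: "g \<in> carrier G"
  have "(\<Sum>\<chi>\<leftarrow>L. \<chi> g) = (\<Sum>\<chi>\<in>set L. of_nat (count_list L \<chi>) * \<chi> g)"
    by (rule sum_list_count_list) auto
  also have "\<dots> = (\<Sum>\<chi>\<in>irreducible_characters G. \<chi> \<one> * \<chi> g)"
    unfolding eq[symmetric] by (intro sum.cong refl) (simp add: count)
  finally show "(\<Sum>\<chi>\<in>irreducible_characters G. \<chi> \<one> * \<chi> g) = (if g = \<one> then of_nat n else 0)"
    using L(2)[OF g] by simp
qed

text \<open>
  Sum the multiplicativity formula for \<open>g\<close> and \<open>inv h\<close> over all characters; the right-hand side becomes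
  values of the regular character, which detect when \<open>t\<close> conjugates \<open>h\<close> to \<open>g\<close>.
\<close>

lemma column_orthogonality:
  assumes g: "g \<in> carrier G" and h: "h \<in> carrier G"
  shows "(\<Sum>\<chi>\<in>irreducible_characters G. \<chi> g * \<chi> (inv h)) = of_nat (card {t \<in> carrier G. t \<otimes> h \<otimes> inv t = g})"
proof -
  have "of_nat n * (\<Sum>\<chi>\<in>irreducible_characters G. \<chi> g * \<chi> (inv h)) =
      (\<Sum>\<chi>\<in>irreducible_characters G. \<chi> \<one> * (\<Sum>t\<in>carrier G. \<chi> (g \<otimes> (t \<otimes> inv h \<otimes> inv t))))"
    unfolding sum_distrib_left[of "of_nat n"]
    by (intro sum.cong refl character_equationsD(4) irreducible_character_equations g inv_closed h)
  also have "\<dots> = (\<Sum>t\<in>carrier G. \<Sum>\<chi>\<in>irreducible_characters G. \<chi> \<one> * \<chi> (g \<otimes> (t \<otimes> inv h \<otimes> inv t)))"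
    unfolding sum_distrib_left by (rule sum.swap)
  also have "\<dots> = (\<Sum>t\<in>carrier G. if t \<otimes> h \<otimes> inv t = g then of_nat n else 0)"
  proof (rule sum.cong[OF refl])
    fix t assume t: "t \<in> carrier G"
    have "t \<otimes> inv h \<otimes> inv t = inv (t \<otimes> h \<otimes> inv t)" using t h by (simp add: conjugate_inv)
    moreover have "g \<otimes> inv x = \<one> \<longleftrightarrow> x = g" if "x \<in> carrier G" for x
      using inv_equality[of g "inv x"] g that by auto
    ultimately have "g \<otimes> (t \<otimes> inv h \<otimes> inv t) = \<one> \<longleftrightarrow> t \<otimes> h \<otimes> inv t = g"
      using t h by simp
    then show "(\<Sum>\<chi>\<in>irreducible_characters G. \<chi> \<one> * \<chi> (g \<otimes> (t \<otimes> inv h \<otimes> inv t))) =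
        (if t \<otimes> h \<otimes> inv t = g then of_nat n else 0)"
      using g t h by (subst regular_character_multiplicities) auto
  qed
  also have "\<dots> = of_nat n * of_nat (card {t \<in> carrier G. t \<otimes> h \<otimes> inv t = g})"
    using fin by (simp add: sum.If_cases Int_def)
  finally show ?thesis using order_pos by simp
qed

end

section \<open>Galois conjugate characters and power maps\<close>

lemma power_sums_as_polynomial:
  assumes N: "N > 0" and "\<And>e. e \<in> set es \<Longrightarrow> e ^ N = 1"
  shows "\<exists>P. \<forall>k. (\<Sum>e\<leftarrow>es. e ^ k) = rpoly P (zeta N ^ k)"
  using assms(2)
proof (induction es)
  case Nil
  show ?case by (intro exI[of _ 0]) simp
next
  case (Cons e es)
  then obtain P where P: "\<And>k. (\<Sum>e\<leftarrow>es. e ^ k) = rpoly P (zeta N ^ k)" by auto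
  obtain j where "e = zeta N ^ j" using root_of_unity_power_form[OF N] Cons.prems[of e] by auto
  then have "e ^ k = rpoly (Polynomial.monom 1 j) (zeta N ^ k)" for k
    unfolding rpoly_simps by (simp add: power_mult[symmetric] mult.commute)
  then show ?case by (intro exI[of _ "Polynomial.monom 1 j + P"]) (simp add: P rpoly_simps)
qed

lemma rpoly_sum: "rpoly (sum F I) z = (\<Sum>i\<in>I. rpoly (F i) z)"
  by (induction I rule: infinite_finite_induct) (auto simp: rpoly_simps)

lemma involution_sum:
  assumes "finite X" "\<And>x. x \<in> X \<Longrightarrow> s x \<in> X" "\<And>x. x \<in> X \<Longrightarrow> s (s x) = x"
    "\<And>x. x \<in> X \<Longrightarrow> s x \<noteq> x" "\<And>x. x \<in> X \<Longrightarrow> F (s x) = F x"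
    "\<And>x. x \<in> X \<Longrightarrow> F x \<in> cyclotomic_integers N"
  shows "\<exists>r\<in>cyclotomic_integers N. sum F X = 2 * r"
  using assms
proof (induction X rule: finite_psubset_induct)
  case (psubset X)
  show ?case
  proof (cases "X = {}")
    case True
    then show ?thesis using cyclotomic_integers.zero by force
  next
    case False
    then obtain x where x: "x \<in> X" by auto
    define Y where "Y = X - {x, s x}"
    have "\<exists>r\<in>cyclotomic_integers N. sum F Y = 2 * r"
    proof (rule psubset.IH)
      show "Y \<subset> X" using x by (auto simp: Y_def)
      show "s y \<in> Y" if "y \<in> Y" for y
        using that psubset.prems(1,2)[of y] psubset.prems(2)[OF x] by (auto simp: Y_def)
    qed (use psubset.prems in \<open>auto simp: Y_def\<close>)
    then obtain r where r: "r \<in> cyclotomic_integers N" "sum F Y = 2 * r" by blast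
    have X: "X = insert x (insert (s x) Y)" using x psubset.prems(1) by (auto simp: Y_def)
    have "finite Y" "x \<notin> insert (s x) Y" "s x \<notin> Y"
      using psubset.hyps psubset.prems(3)[OF x] by (auto simp: Y_def)
    then have "sum F (insert x (insert (s x) Y)) = F x + (F (s x) + sum F Y)" by simp
    then have "sum F X = 2 * (F x + r)" using r psubset.prems(4)[OF x] X by (simp add: algebra_simps)
    then show ?thesis
      by (rule bexI) (intro cyclotomic_integers.add psubset.prems(5)[OF x] r(1))
  qed
qed

context finite_group
begin

lemma pow_cong:
  assumes g: "g \<in> carrier G" and m: "g [^] (m::nat) = \<one>" and ab: "[a = b] (mod m)"
  shows "g [^] a = g [^] b"
proof -
  have "g [^] c = g [^] (c mod m)" for c :: nat
  proof -
    have "g [^] c = g [^] (m * (c div m) + c mod m)" by simp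
    also have "\<dots> = (g [^] m) [^] (c div m) \<otimes> g [^] (c mod m)"
      using g by (simp add: nat_pow_mult nat_pow_pow del: mult_div_mod_eq)
    finally show ?thesis using g m by simp
  qed
  then show ?thesis using ab unfolding cong_def by metis
qed

lemma pow_cong_order:
  "g \<in> carrier G \<Longrightarrow> [a = b] (mod n) \<Longrightarrow> g [^] a = g [^] b"
  using pow_cong[of g n] pow_order_eq_1 by blast

lemma conjugate_pow:
  fixes k :: nat
  assumes t: "t \<in> carrier G" and g: "g \<in> carrier G"
  shows "(t \<otimes> g \<otimes> inv t) [^] k = t \<otimes> g [^] k \<otimes> inv t"
proof (induction k)
  case (Suc k)
  have "inv t \<otimes> (t \<otimes> x) = x" if "x \<in> carrier G" for x
    using t that by (simp add: m_assoc[symmetric])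
  then show ?case using Suc t g by (simp add: m_assoc)
qed (use t in simp)

lemma character_power_sum:
  assumes \<chi>: "\<chi> \<in> irreducible_characters G" and g: "g \<in> carrier G"
  obtains es where "\<And>k::nat. \<chi> (g [^] k) = (\<Sum>e\<leftarrow>es. e ^ k)" "\<And>e. e \<in> set es \<Longrightarrow> e ^ n = 1"
proof -
  obtain d \<rho> where \<chi>: "\<chi> = afforded_character G \<rho>" and irr: "irreducible_representation G d \<rho>"
    using \<chi> by (auto simp: irreducible_characters_def)
  have rep: "representation G d \<rho>" using irr by (auto simp: irreducible_representation_def)
  note \<rho> = representationD[OF group_axioms rep]
  have pow: "\<rho> (g [^] k) = \<rho> g ^\<^sub>m k" for k :: nat
    using g \<rho>(1)[OF g] by (induction k) (auto simp: \<rho>(2,3))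
  obtain es where es: "\<And>k. mat_trace (\<rho> g ^\<^sub>m k) = (\<Sum>e\<leftarrow>es. e ^ k)"
    "\<And>N e. \<rho> g ^\<^sub>m N = 1\<^sub>m d \<Longrightarrow> e \<in> set es \<Longrightarrow> e ^ N = 1"
    using trace_powers_eigenvalues[OF \<rho>(1)[OF g]] by metis
  have "\<rho> g ^\<^sub>m n = 1\<^sub>m d" using pow[of n] g pow_order_eq_1 \<rho>(3) by simp
  then show thesis using es g that[of es] by (simp add: \<chi> afforded_character_def pow)
qed

lemma character_polynomial:
  assumes \<chi>: "\<chi> \<in> irreducible_characters G" and g: "g \<in> carrier G"
  shows "\<exists>P. \<forall>k::nat. \<chi> (g [^] k) = rpoly P (zeta n ^ k)"
proof -
  obtain es where "\<And>k::nat. \<chi> (g [^] k) = (\<Sum>e\<leftarrow>es. e ^ k)" "\<And>e. e \<in> set es \<Longrightarrow> e ^ n = 1"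
    using character_power_sum[OF assms] by blast
  then show ?thesis using power_sums_as_polynomial[OF order_pos, of es] by metis
qed

lemma character_cyclotomic_integer:
  assumes \<chi>: "\<chi> \<in> irreducible_characters G" and g: "g \<in> carrier G"
  shows "\<chi> g \<in> cyclotomic_integers n"
proof -
  obtain es where es: "\<And>k::nat. \<chi> (g [^] k) = (\<Sum>e\<leftarrow>es. e ^ k)" "\<And>e. e \<in> set es \<Longrightarrow> e ^ n = 1"
    using character_power_sum[OF assms] by blast
  have "\<chi> g = (\<Sum>e\<leftarrow>es. e)" using es(1)[of 1] g by simp
  also have "\<dots> \<in> cyclotomic_integers n" using es(2)
    by (induction es) (auto intro: cyclotomic_integers.intros)
  finally show ?thesis .
qed

lemma sum_power_map:
  fixes F :: "'a \<Rightarrow> complex"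
  assumes k: "coprime k n"
  shows "(\<Sum>g\<in>carrier G. F (g [^] k)) = (\<Sum>g\<in>carrier G. F g)"
proof -
  obtain l where l: "[k * l = Suc 0] (mod n)" using cong_solve_coprime_nat[OF k] by blast
  have kl: "g [^] (k * l) = g" if "g \<in> carrier G" for g
    using pow_cong_order[OF that l] that by simp
  show ?thesis
    by (rule sum.reindex_bij_witness[of _ "\<lambda>g. g [^] l" "\<lambda>g. g [^] k"])
      (auto simp: nat_pow_pow kl mult.commute[of l])
qed

text \<open>
  The defining equations of irreducible characters are rational relations between the roots of unity
  that make up the character values, and raising these to the power \<open>k\<close> evaluates the character at
  \<open>k\<close>-th powers of group elements.
\<close>

lemma galois_conjugate_character:
  assumes f: "f \<in> irreducible_characters G" and k: "coprime k n"
  shows "(\<lambda>g\<in>carrier G. f (g [^] k)) \<in> irreducible_characters G"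
proof -
  let ?h = "\<lambda>g\<in>carrier G. f (g [^] k)"
  note fD = character_equationsD[OF irreducible_character_equations[OF f]]
  obtain d where d: "d > 0" "f \<one> = of_nat d" using fD(3) by blast
  have "\<forall>g\<in>carrier G. \<exists>P. \<forall>j::nat. f (g [^] j) = rpoly P (zeta n ^ j)"
    using character_polynomial[OF f] by blast
  then obtain P where P: "\<And>g j. g \<in> carrier G \<Longrightarrow> f (g [^] (j::nat)) = rpoly (P g) (zeta n ^ j)"
    by metis
  have "of_nat n * (f (g [^] k) * f (h [^] k)) = of_nat d * (\<Sum>t\<in>carrier G. f ((g \<otimes> (t \<otimes> h \<otimes> inv t)) [^] k))"
    if g: "g \<in> carrier G" and h: "h \<in> carrier G" for g h
  proof -
    define F where "F = [:of_nat n:] * (P g * P h) - [:of_nat d:] * (\<Sum>t\<in>carrier G. P (g \<otimes> (t \<otimes> h \<otimes> inv t)))"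
    have F: "rpoly F (zeta n ^ j) = of_nat n * (f (g [^] j) * f (h [^] j)) - 
        of_nat d * (\<Sum>t\<in>carrier G. f ((g \<otimes> (t \<otimes> h \<otimes> inv t)) [^] j))" for j :: nat
      using g h by (simp add: F_def rpoly_simps rpoly_sum P)
    have "rpoly F (zeta n) = 0"
      using F[of 1] fD(4)[OF g h] g h d by simp
    then have "rpoly F (zeta n ^ k) = 0"
      by (rule rational_relation_coprime_power[OF order_pos zeta_power_eq_1[OF order_pos] _ k])
    then show ?thesis unfolding F by simp
  qed
  moreover have "pairing ?h ?h = of_nat n"
  proof -
    have "pairing ?h ?h = (\<Sum>g\<in>carrier G. f (g [^] k) * f (inv (g [^] k)))"
      unfolding pairing_def by (intro sum.cong refl) (simp add: nat_pow_inv)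
    also have "\<dots> = (\<Sum>g\<in>carrier G. f g * f (inv g))" by (rule sum_power_map[OF k])
    finally show ?thesis using fD(5) by (simp add: pairing_def)
  qed
  ultimately have "character_equations ?h"
    unfolding character_equations_def using d by auto
  then show ?thesis by (simp add: irreducible_characters_eq)
qed

text \<open>
  The parity argument. If \<open>f\<close> and \<open>f'\<close> differ, then \<open>n\<close> is the pairing of \<open>f\<close> with \<open>f - f'\<close>. Elements
  fixed by the power map contribute nothing, and the others contribute in equal pairs.
\<close>

lemma characters_determined_by_fixed_elements:
  assumes odd: "odd n" and kk: "[k * k = 1] (mod n)"
    and f: "f \<in> irreducible_characters G" "\<And>g. g \<in> carrier G \<Longrightarrow> f (g [^] k) = f g"
    and f': "f' \<in> irreducible_characters G" "\<And>g. g \<in> carrier G \<Longrightarrow> f' (g [^] k) = f' g"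
    and agree: "\<And>g. g \<in> carrier G \<Longrightarrow> g [^] k = g \<Longrightarrow> f g = f' g"
  shows "f = f'"
proof (rule ccontr)
  assume ne: "f \<noteq> f'"
  define F where "F g = f g * (f (inv g) - f' (inv g))" for g
  define X where "X = {g \<in> carrier G. g [^] k \<noteq> g}"
  have "of_nat n = pairing f f - pairing f f'"
    using pairing_irreducible f(1) f'(1) ne by simp
  also have "\<dots> = (\<Sum>g\<in>carrier G. F g)"
    by (simp add: pairing_def F_def sum_subtractf right_diff_distrib)
  also have "\<dots> = (\<Sum>g\<in>X. F g)"
  proof (rule sum.mono_neutral_right)
    show "\<forall>g\<in>carrier G - X. F g = 0"
    proof
      fix g assume "g \<in> carrier G - X"
      then have g: "g \<in> carrier G" "g [^] k = g" by (auto simp: X_def)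
      then have "(inv g) [^] k = inv g" by (simp add: nat_pow_inv)
      then show "F g = 0" using agree[of "inv g"] g by (simp add: F_def)
    qed
  qed (use fin in \<open>auto simp: X_def\<close>)
  finally have sum: "(\<Sum>g\<in>X. F g) = of_nat n" by simp
  have inv: "(g [^] k) [^] k = g" if "g \<in> carrier G" for g
    using pow_cong_order[OF that kk] that by (simp add: nat_pow_pow)
  have "\<exists>r\<in>cyclotomic_integers n. sum F X = 2 * r"
  proof (rule involution_sum[where s = "\<lambda>g. g [^] k"])
    show "finite X" using fin by (simp add: X_def)
    show "x [^] k \<in> X" if "x \<in> X" for x
      using that inv[of x] by (auto simp: X_def)
    show "(x [^] k) [^] k = x" if "x \<in> X" for x using that inv by (auto simp: X_def)
    show "x [^] k \<noteq> x" if "x \<in> X" for x using that by (auto simp: X_def)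
    show "F (x [^] k) = F x" if "x \<in> X" for x
      using that f(2)[of x] f(2)[of "inv x"] f'(2)[of "inv x"] by (auto simp: X_def F_def nat_pow_inv)
    show "F x \<in> cyclotomic_integers n" if "x \<in> X" for x
      using that f(1) f'(1) unfolding F_def X_def
      by (intro cyclotomic_integers_mult cyclotomic_integers_diff character_cyclotomic_integer) auto
  qed
  then obtain r where r: "r \<in> cyclotomic_integers n" "of_nat n = 2 * r" using sum by auto
  then have half: "r = of_nat n / 2" by simp
  have "r \<in> \<rat>" unfolding half by simp
  then obtain m where "r = of_int m"
    using cyclotomic_integer_rational[OF order_pos r(1)] by (auto elim: Ints_cases)
  then have "(of_int (int n) :: complex) = of_int (2 * m)" using r(2) by simp
  then have "int n = 2 * m" by (simp only: of_int_eq_iff)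
  then show False using odd by presburger
qed

text \<open>
  The permutation lemma of Brauer for power maps, under the hypothesis that a class stable under the map
  is fixed elementwise. Pairing each character with its conjugate counts \<open>n\<close> for every fixed character;
  by column orthogonality the same sum counts, for each \<open>g\<close>, the elements conjugating \<open>g\<close> to \<open>g ^ k\<close>,
  and each fixed class contributes \<open>n\<close> by the orbit-stabilizer theorem.
\<close>

lemma card_fixed_characters:
  assumes k: "coprime k n"
    and conj: "\<And>g t. g \<in> carrier G \<Longrightarrow> t \<in> carrier G \<Longrightarrow> t \<otimes> g \<otimes> inv t = g [^] k \<Longrightarrow> g [^] k = g"
  shows "card {f \<in> irreducible_characters G. \<forall>g\<in>carrier G. f (g [^] k) = f g} =
    card {C \<in> conj_classes G. \<forall>g\<in>C. g [^] k = g}"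
proof -
  let ?I = "irreducible_characters G"
  define \<phi> where "\<phi> = (\<lambda>g. \<lambda>h\<in>carrier G. g \<otimes> h \<otimes> inv g)"
  interpret A: group_action G "carrier G" \<phi> unfolding \<phi>_def by (rule action_by_conjugation)
  define K where "K = {C \<in> conj_classes G. \<forall>g\<in>C. g [^] k = g}"
  define S where "S = {g \<in> carrier G. g [^] k = g}"
  have cl: "conj_classes G = orbits G (carrier G) \<phi>" by (simp add: conj_classes_def \<phi>_def)
  have CG: "C \<subseteq> carrier G" if "C \<in> conj_classes G" for C
    using that A.orbits_coverture unfolding cl by blast
  have finK: "finite K"
  proof (rule finite_subset)
    show "K \<subseteq> Pow (carrier G)" using CG by (auto simp: K_def)
  qed (use fin in simp)
  have disj: "C \<inter> D = {}" if "C \<in> conj_classes G" "D \<in> conj_classes G" "C \<noteq> D" for C D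
    using A.disjoint_union that unfolding cl by blast
  have S: "S = \<Union>K"
  proof (intro equalityI subsetI)
    fix g assume "g \<in> S"
    then have g: "g \<in> carrier G" "g [^] k = g" by (auto simp: S_def)
    have "orbit G \<phi> g \<in> K" unfolding K_def cl orbits_def
      using g by (auto simp: orbit_def \<phi>_def conjugate_pow)
    moreover have "g \<in> orbit G \<phi> g" using A.orbit_refl[OF g(1)] by simp
    ultimately show "g \<in> \<Union>K" by blast
  qed (use CG in \<open>auto simp: K_def S_def\<close>)
  have "of_nat n * of_nat (card {f \<in> ?I. \<forall>g\<in>carrier G. f (g [^] k) = f g}) =
      (\<Sum>f\<in>?I. if \<forall>g\<in>carrier G. f (g [^] k) = f g then of_nat n else (0::complex))"
    using finite_irreducible_characters by (simp add: sum.If_cases Int_def)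
  also have "\<dots> = (\<Sum>f\<in>?I. \<Sum>g\<in>carrier G. f (g [^] k) * f (inv g))"
  proof (rule sum.cong[OF refl])
    fix f assume f: "f \<in> ?I"
    let ?h = "\<lambda>g\<in>carrier G. f (g [^] k)"
    have "f \<in> extensional (carrier G)"
      using irreducible_character_equations[OF f] character_equationsD(1) by blast
    then have iff: "?h = f \<longleftrightarrow> (\<forall>g\<in>carrier G. f (g [^] k) = f g)"
      by (auto simp: fun_eq_iff extensional_def restrict_def)
    have "(\<Sum>g\<in>carrier G. f (g [^] k) * f (inv g)) = pairing ?h f" by (simp add: pairing_def)
    also have "\<dots> = (if ?h = f then of_nat n else 0)"
      by (rule pairing_irreducible[OF galois_conjugate_character[OF f k] f])
    finally show "(if \<forall>g\<in>carrier G. f (g [^] k) = f g then of_nat n else (0::complex)) =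
        (\<Sum>g\<in>carrier G. f (g [^] k) * f (inv g))" unfolding iff by simp
  qed
  also have "\<dots> = (\<Sum>g\<in>carrier G. of_nat (card {t \<in> carrier G. t \<otimes> g \<otimes> inv t = g [^] k}))"
    by (subst sum.swap) (intro sum.cong refl column_orthogonality, auto)
  also have "\<dots> = (\<Sum>g\<in>S. of_nat (card (stabilizer G \<phi> g)))"
  proof (rule sum.mono_neutral_cong_right)
    show "\<forall>g\<in>carrier G - S. of_nat (card {t \<in> carrier G. t \<otimes> g \<otimes> inv t = g [^] k}) = (0::complex)"
    proof
      fix g assume "g \<in> carrier G - S"
      then have "{t \<in> carrier G. t \<otimes> g \<otimes> inv t = g [^] k} = {}" using conj[of g] by (auto simp: S_def)
      then show "of_nat (card {t \<in> carrier G. t \<otimes> g \<otimes> inv t = g [^] k}) = (0::complex)"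
        by (simp only: card.empty of_nat_0)
    qed
    show "of_nat (card {t \<in> carrier G. t \<otimes> g \<otimes> inv t = g [^] k}) = 
        (of_nat (card (stabilizer G \<phi> g)) :: complex)" if "g \<in> S" for g
      using that by (simp add: stabilizer_def \<phi>_def S_def)
  qed (use fin in \<open>auto simp: S_def\<close>)
  also have "\<dots> = (\<Sum>C\<in>K. \<Sum>g\<in>C. of_nat (card (stabilizer G \<phi> g)))"
    unfolding S
  proof (rule sum.Union_disjoint[unfolded comp_def])
    show "\<forall>C\<in>K. finite C" using CG fin by (auto simp: K_def intro: finite_subset)
    show "\<forall>C\<in>K. \<forall>D\<in>K. C \<noteq> D \<longrightarrow> C \<inter> D = {}" using disj by (simp add: K_def)
  qed
  also have "\<dots> = (\<Sum>C\<in>K. of_nat n)"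
  proof (rule sum.cong[OF refl])
    fix C assume "C \<in> K"
    then have "C \<in> orbits G (carrier G) \<phi>" by (simp add: K_def cl)
    then show "(\<Sum>g\<in>C. of_nat (card (stabilizer G \<phi> g))) = (of_nat n :: complex)"
      using A.card_stablizer_sum[OF fin] by (metis of_nat_sum)
  qed
  also have "\<dots> = of_nat n * of_nat (card K)" by simp
  finally have "(of_nat (card {f \<in> ?I. \<forall>g\<in>carrier G. f (g [^] k) = f g}) :: complex) = of_nat (card K)"
    using order_pos by simp
  then show ?thesis unfolding K_def by (simp only: of_nat_eq_iff)
qed

end

section \<open>Real elements and real characters in odd order\<close>

context finite_group
begin

text \<open>
  The square of \<open>t\<close> centralises \<open>y\<close>; as \<open>t\<close> is a power of its square in odd order, so does \<open>t\<close>. Hence \<open>y\<close>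
  equals its inverse, and an element of odd order with this property is trivial.
\<close>

lemma odd_real_element_trivial:
  assumes odd: "odd n" and t: "t \<in> carrier G" and y: "y \<in> carrier G"
    and eq: "t \<otimes> y \<otimes> inv t = inv y"
  shows "y = \<one>"
proof -
  have cancel: "inv t \<otimes> (t \<otimes> x) = x" if "x \<in> carrier G" for x
    using t that by (simp add: m_assoc[symmetric])
  have ty: "t \<otimes> y = inv y \<otimes> t"
    using eq t y by (metis inv_closed inv_solve_right m_closed)
  have ty': "t \<otimes> inv y = y \<otimes> t"
  proof -
    have "t \<otimes> inv y \<otimes> inv t = inv (t \<otimes> y \<otimes> inv t)" by (simp add: conjugate_inv t y)
    then have "t \<otimes> inv y \<otimes> inv t = y" using eq y by simp
    then show ?thesis using t y by (metis inv_closed inv_solve_right m_closed)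
  qed
  define s where "s = t \<otimes> t"
  have s: "s \<in> carrier G" using t by (simp add: s_def)
  have sy: "s \<otimes> y = y \<otimes> s"
  proof -
    have "t \<otimes> t \<otimes> y = t \<otimes> (inv y \<otimes> t)" using t y ty by (simp add: m_assoc)
    also have "\<dots> = y \<otimes> t \<otimes> t" using t y ty' by (simp add: m_assoc[symmetric])
    finally show ?thesis using t y by (simp add: s_def m_assoc)
  qed
  have sk: "s [^] k \<otimes> y = y \<otimes> s [^] k" for k :: nat
  proof (induction k)
    case (Suc k)
    have "s [^] k \<otimes> s \<otimes> y = s [^] k \<otimes> (y \<otimes> s)" using s y by (simp add: m_assoc sy)
    also have "\<dots> = y \<otimes> s [^] k \<otimes> s" using s y Suc by (simp add: m_assoc[symmetric])
    finally show ?case using s y by (simp add: m_assoc)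
  qed (use y in simp)
  obtain m where m: "n = 2 * m + 1" using odd by (auto elim: oddE)
  have "s = t [^] (2::nat)" using t by (simp add: s_def numeral_2_eq_2)
  then have "s [^] (m + 1) = t [^] (2 * (m + 1))" by (simp only: nat_pow_pow[OF t])
  also have "2 * (m + 1) = n + 1" using m by simp
  also have "t [^] (n + 1) = t" using t pow_order_eq_1[OF t] by simp
  finally have "s [^] (m + 1) = t" .
  then have "t \<otimes> y = y \<otimes> t" using sk[of "m + 1"] by (simp only:)
  then have "inv y \<otimes> t = y \<otimes> t" by (rule trans[OF ty[symmetric]])
  then have yi: "inv y = y" by (rule iffD1[OF right_cancel[OF t inv_closed[OF y] y]])
  have "y \<otimes> y = \<one>" using l_inv[OF y] unfolding yi .
  then have yy: "y [^] (2::nat) = \<one>" using y by (simp add: numeral_2_eq_2)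
  have "y = y [^] (1::nat)" using y by simp
  also have "\<dots> = y [^] n" by (rule pow_cong[OF y yy]) (use m in \<open>simp add: cong_def\<close>)
  also have "\<dots> = \<one>" using pow_order_eq_1[OF y] .
  finally show ?thesis .
qed

lemma trivial_character: "(\<lambda>g\<in>carrier G. 1) \<in> irreducible_characters G"
proof -
  have "character_equations (\<lambda>g\<in>carrier G. 1)"
    unfolding character_equations_def pairing_def using fin
    by (auto simp: Coset.order_def intro!: exI[of _ "1::nat"])
  then show ?thesis by (simp add: irreducible_characters_eq)
qed

lemma pow_order_minus_1: "g \<in> carrier G \<Longrightarrow> g [^] (n - 1) = inv g"
proof -
  assume g: "g \<in> carrier G"
  have "g [^] (n - 1) \<otimes> g = g [^] n" using order_pos by (metis Suc_diff_1 nat_pow_Suc)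
  then show ?thesis using g pow_order_eq_1[OF g] by (metis inv_equality nat_pow_closed)
qed

text \<open>
  Burnside: by the permutation lemma for inversion there are as many real irreducible characters as real
  classes, namely one.
\<close>

lemma real_character_trivial:
  assumes odd: "odd n" and f: "f \<in> irreducible_characters G" 
    and real: "\<And>g. g \<in> carrier G \<Longrightarrow> f (inv g) = f g"
  shows "f = (\<lambda>g\<in>carrier G. 1)"
proof -
  let ?R = "{f \<in> irreducible_characters G. \<forall>g\<in>carrier G. f (g [^] (n - 1)) = f g}"
  have "coprime (n - 1) n" using order_pos by (metis Suc_diff_1 coprime_Suc_left_nat coprime_commute)
  then have card: "card ?R = card {C \<in> conj_classes G. \<forall>g\<in>C. g [^] (n - 1) = g}"
  proof (rule card_fixed_characters)
    fix g t assume g: "g \<in> carrier G" and t: "t \<in> carrier G" and "t \<otimes> g \<otimes> inv t = g [^] (n - 1)"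
    then have "t \<otimes> g \<otimes> inv t = inv g" unfolding pow_order_minus_1[OF g] by blast
    then have "g = \<one>" by (rule odd_real_element_trivial[OF odd t g])
    then show "g [^] (n - 1) = g" by simp
  qed
  have sub: "{C \<in> conj_classes G. \<forall>g\<in>C. g [^] (n - 1) = g} \<subseteq> {{\<one>}}"
  proof
    fix C assume "C \<in> {C \<in> conj_classes G. \<forall>g\<in>C. g [^] (n - 1) = g}"
    then obtain x where x: "x \<in> carrier G" "C = {g \<otimes> x \<otimes> inv g |g. g \<in> carrier G}" 
      "\<forall>g\<in>C. g [^] (n - 1) = g"
      by (auto simp: conj_classes_def orbits_def orbit_def)
    have "\<one> \<otimes> x \<otimes> inv \<one> \<in> C" unfolding x(2) by blast
    then have "x \<in> C" using x(1) by simp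
    then have "x [^] (n - 1) = x" using x(3) by blast
    then have "inv x = x" unfolding pow_order_minus_1[OF x(1)] .
    then have "\<one> \<otimes> x \<otimes> inv \<one> = inv x" using x(1) by simp
    then have "x = \<one>" by (rule odd_real_element_trivial[OF odd one_closed x(1)])
    moreover have "{g \<otimes> \<one> \<otimes> inv g |g. g \<in> carrier G} = {\<one>}"
      by (auto intro!: exI[of _ "\<one>"])
    ultimately show "C \<in> {{\<one>}}" using x(2) by simp
  qed
  have "card {C \<in> conj_classes G. \<forall>g\<in>C. g [^] (n - 1) = g} \<le> card {{\<one>}}"
    by (rule card_mono[OF _ sub]) simp
  then have "card ?R \<le> Suc 0" unfolding card by simp
  then have single: "\<forall>a\<in>?R. \<forall>b\<in>?R. a = b"
    by (rule iffD1[OF card_le_Suc0_iff_eq, rotated]) (simp add: finite_irreducible_characters)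
  have "f \<in> ?R" using f real by (simp add: pow_order_minus_1[unfolded One_nat_def])
  moreover have "(\<lambda>g\<in>carrier G. 1) \<in> ?R" using trivial_character by simp
  ultimately show ?thesis by (rule single[THEN bspec, THEN bspec])
qed

end

section \<open>Characters with values in the field of a prime\<close>

text \<open>
  The numbers \<open>A\<close> and \<open>B\<close> are the idempotents of the Chinese remainder theorem for \<open>n = p ^ c * n'\<close>:
  raising to the power \<open>A\<close> and to the power \<open>B\<close> project to the \<open>p'\<close>-part and to the \<open>p\<close>-part.
\<close>

locale finite_group_prime = finite_group +
  fixes p c n' A B :: nat
  assumes p: "Factorial_Ring.prime p" and order: "Coset.order G = p ^ c * n'" and n': "\<not> p dvd n'"
    and A: "[A = 1] (mod n')" "[A = 0] (mod p ^ c)"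
    and B: "[B = 0] (mod n')" "[B = 1] (mod p ^ c)"
begin

lemma coprime_parts: "coprime (p ^ k) n'"
  using p n' by (simp add: prime_imp_coprime)

lemma n'_pos: "n' > 0"
  using order_pos order by (auto intro: Nat.gr0I)

text \<open>
  The exponent congruent to \<open>1\<close> modulo \<open>p ^ c\<close> and to \<open>u\<close> modulo \<open>n'\<close>: the automorphism fixing \<open>p\<close>-power
  roots of unity and raising those of order prime to \<open>p\<close> to the power \<open>u\<close>.
\<close>

definition galois_exponent :: "nat \<Rightarrow> nat" where
  "galois_exponent u = A * u + B"

lemma galois_exponent_cong:
  "[galois_exponent u = 1] (mod p ^ c)" "[galois_exponent u = u] (mod n')"
proof -
  have "[A * u + B = 0 * u + 1] (mod p ^ c)" by (intro cong_add cong_mult A B cong_refl)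
  then show "[galois_exponent u = 1] (mod p ^ c)" by (simp add: galois_exponent_def)
  have "[A * u + B = 1 * u + 0] (mod n')" by (intro cong_add cong_mult A B cong_refl)
  then show "[galois_exponent u = u] (mod n')" by (simp add: galois_exponent_def)
qed

lemma cong_order:
  "[a = b] (mod p ^ c) \<Longrightarrow> [a = b] (mod n') \<Longrightarrow> [a = b] (mod n)"
  unfolding order by (intro coprime_cong_mult_nat coprime_parts)

lemma coprime_galois_exponent:
  assumes "coprime u n'"
  shows "coprime (galois_exponent u) n"
proof -
  have "coprime (galois_exponent u) (p ^ c)"
    using cong_imp_coprime[OF cong_sym[OF galois_exponent_cong(1)]] by simp
  moreover have "coprime (galois_exponent u) n'"
    using cong_imp_coprime[OF cong_sym[OF galois_exponent_cong(2)] assms] .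
  ultimately show ?thesis unfolding order by simp
qed

text \<open>
  Here \<open>n' - 1\<close> stands for \<open>-1\<close> modulo \<open>n'\<close>.
\<close>

definition \<kappa> :: nat where "\<kappa> = galois_exponent (n' - 1)"

lemma coprime_pred: "coprime (n' - 1) n'"
  using n'_pos by (metis Suc_diff_1 coprime_Suc_left_nat coprime_commute)

lemma coprime_\<kappa>: "coprime \<kappa> n"
  unfolding \<kappa>_def by (rule coprime_galois_exponent[OF coprime_pred])

lemma \<kappa>_square: "[\<kappa> * \<kappa> = 1] (mod n)"
proof (rule cong_order)
  show "[\<kappa> * \<kappa> = 1] (mod p ^ c)"
    unfolding \<kappa>_def using cong_mult[OF galois_exponent_cong(1) galois_exponent_cong(1)] by simp
  have "[\<kappa> * \<kappa> = (n' - 1) * (n' - 1)] (mod n')"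
    unfolding \<kappa>_def by (intro cong_mult galois_exponent_cong)
  moreover have "[(n' - 1) * (n' - 1) = 1] (mod n')"
  proof (cases "n' = 1")
    case False
    then obtain m where m: "n' = Suc (Suc m)" using n'_pos by (metis One_nat_def not0_implies_Suc not_gr0)
    have "(n' - 1) * (n' - 1) = n' * m + 1" by (simp add: m algebra_simps)
    then show ?thesis by (simp only: cong_def mod_mult_self4)
  qed simp
  ultimately show "[\<kappa> * \<kappa> = 1] (mod n')" by (rule cong_trans)
qed

lemma pow_galois_exponent_fixed: "g \<in> carrier G \<Longrightarrow> g [^] (p ^ c) = \<one> \<Longrightarrow> g [^] galois_exponent u = g"
  using pow_cong[of g "p ^ c" "galois_exponent u" 1] galois_exponent_cong(1) by simp

text \<open>
  The element \<open>g ^ (p ^ c)\<close> generates the \<open>p'\<close>-part of the cyclic group of \<open>g\<close>, and on it \<open>\<kappa>\<close> acts as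
  inversion.
\<close>

lemma conjugate_\<kappa>_power:
  assumes odd: "odd n" and g: "g \<in> carrier G" and t: "t \<in> carrier G" and eq: "t \<otimes> g \<otimes> inv t = g [^] \<kappa>"
  shows "g [^] (p ^ c) = \<one>"
proof -
  define y where "y = g [^] (p ^ c)"
  have y: "y \<in> carrier G" using g by (simp add: y_def)
  have yn: "y [^] n' = \<one>" using g pow_order_eq_1[OF g] by (simp add: y_def nat_pow_pow order)
  have "t \<otimes> y \<otimes> inv t = (t \<otimes> g \<otimes> inv t) [^] (p ^ c)" by (simp add: y_def conjugate_pow g t)
  also have "\<dots> = y [^] \<kappa>" using g by (simp add: eq y_def nat_pow_pow mult.commute)
  also have "\<dots> = y [^] (n' - 1)" unfolding \<kappa>_def
    by (rule pow_cong[OF y yn galois_exponent_cong(2)])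
  also have "\<dots> = inv y"
  proof -
    have "y [^] (n' - 1) \<otimes> y = y [^] n'" using n'_pos by (metis Suc_diff_1 nat_pow_Suc)
    then show ?thesis using y yn by (metis inv_equality nat_pow_closed)
  qed
  finally show ?thesis using odd_real_element_trivial[OF odd t y] by (simp add: y_def)
qed

lemma fixed_iff:
  assumes odd: "odd n" and g: "g \<in> carrier G"
  shows "g [^] \<kappa> = g \<longleftrightarrow> g [^] (p ^ c) = \<one>"
  using conjugate_\<kappa>_power[OF odd g one_closed] pow_galois_exponent_fixed[OF g] g by (auto simp: \<kappa>_def)

lemma p_power_order_iff:
  assumes g: "g \<in> carrier G"
  shows "(\<exists>a. ord g = p ^ a) \<longleftrightarrow> g [^] (p ^ c) = \<one>"
proof
  assume "\<exists>a. ord g = p ^ a"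
  then obtain a where a: "ord g = p ^ a" by blast
  have "p ^ a dvd p ^ c * n'" using ord_dvd_group_order[OF g] by (simp add: a order)
  then have "p ^ a dvd p ^ c" using coprime_parts by (simp add: coprime_dvd_mult_left_iff)
  then show "g [^] (p ^ c) = \<one>" using pow_eq_id[OF g] by (simp add: a)
next
  assume "g [^] (p ^ c) = \<one>"
  then have "ord g dvd p ^ c" using pow_eq_id[OF g] by simp
  then show "\<exists>a. ord g = p ^ a" using divides_primepow_nat[OF p] by auto
qed

text \<open>
  Both \<open>f g\<close>, as a sum of \<open>n\<close>-th roots of unity, and its expression as a polynomial in a root of unity
  of order \<open>p ^ a\<close> live in the cyclotomic field of order \<open>N = n * p ^ a\<close>. Since \<open>a\<close> may exceed \<open>c\<close>, the
  exponent \<open>k\<close> is first replaced by one that is congruent to \<open>1\<close> modulo \<open>p ^ (c + a)\<close>.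
\<close>

lemma Q_field_values_fixed:
  assumes f: "f \<in> irreducible_characters G" and vals: "\<And>g. g \<in> carrier G \<Longrightarrow> f g \<in> Q_field p"
    and k: "coprime k n" "[k = 1] (mod p ^ c)" and g: "g \<in> carrier G"
  shows "f (g [^] k) = f g"
proof -
  obtain a P where P: "f g = rpoly P (zeta (p ^ a))"
    using Q_field_as_polynomial[OF p vals[OF g]] by blast
  obtain S where S: "\<And>j::nat. f (g [^] j) = rpoly S (zeta n ^ j)"
    using character_polynomial[OF f g] by blast
  have pa: "p ^ a > 0" using p by (simp add: prime_gt_0_nat)
  define N where "N = n * p ^ a"
  have N: "N > 0" using order_pos pa by (simp add: N_def)
  have z1: "zeta N ^ (p ^ a) = zeta n" unfolding N_def by (rule zeta_mult_power[OF pa])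
  have z2: "zeta N ^ n = zeta (p ^ a)" unfolding N_def using zeta_mult_power[OF order_pos, of "p ^ a"]
    by (simp only: mult.commute)
  obtain k' where k': "[k' = 1] (mod p ^ (c + a))" "[k' = k] (mod n')"
    using binary_chinese_remainder_nat[OF coprime_parts] by blast
  have "[k' = 1] (mod p ^ c)" "[k' = 1] (mod p ^ a)"
    using k'(1) by (auto simp: power_add intro: cong_modulus_mult_nat cong_modulus_mult_nat[where n = "p ^ c"] simp: mult.commute)
  then have kk: "[k' = k] (mod n)"
    using k(2) k'(2) by (intro cong_order) (auto intro: cong_trans cong_sym)
  have "coprime k' (p ^ (c + a))" using cong_imp_coprime[OF cong_sym[OF k'(1)]] by simp
  moreover have "coprime k' n'"
    using cong_imp_coprime[OF cong_sym[OF k'(2)]] k(1) by (simp add: order)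
  moreover have "N = p ^ (c + a) * n'" by (simp add: N_def order power_add mult_ac)
  ultimately have cop: "coprime k' N" by simp
  define F where "F = pcompose S (Polynomial.monom 1 (p ^ a)) - pcompose P (Polynomial.monom 1 n)"
  have F: "rpoly F z = rpoly S (z ^ (p ^ a)) - rpoly P (z ^ n)" for z
    by (simp add: F_def rpoly_simps rpoly_pcompose_monom)
  have "rpoly F (zeta N) = 0" using S[of 1] P g by (simp add: F z1 z2)
  then have "rpoly F (zeta N ^ k') = 0"
    by (rule rational_relation_coprime_power[OF N zeta_power_eq_1[OF N] _ cop])
  then have "rpoly S (zeta n ^ k') = rpoly P (zeta (p ^ a) ^ k')"
    unfolding F z1[symmetric] z2[symmetric] by (simp add: power_mult[symmetric] mult.commute)
  also have "zeta (p ^ a) ^ k' = zeta (p ^ a)"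
  proof -
    have "k' mod p ^ a = 1 mod p ^ a" using \<open>[k' = 1] (mod p ^ a)\<close> by (simp add: cong_def)
    then have "zeta (p ^ a) ^ k' = zeta (p ^ a) ^ 1"
      using zeta_power_eq_1[OF pa] by (metis div_mult_mod_eq power_add power_mult power_one mult.commute)
    then show ?thesis by simp
  qed
  finally have "f (g [^] k') = f g" using S P by simp
  then show ?thesis using pow_cong_order[OF g kk] by simp
qed

text \<open>
  By the parity argument \<open>f\<close> is invariant under all exponents \<open>galois_exponent u\<close>. Averaging over \<open>u\<close>
  replaces each eigenvalue \<open>e\<close> by its \<open>p\<close>-part \<open>e ^ B\<close> times a Ramanujan sum of its \<open>p'\<close>-part.
\<close>

lemma fixed_values_Q_field:
  assumes odd: "odd n" and f: "f \<in> irreducible_characters G" 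
    and fixed: "\<And>g. g \<in> carrier G \<Longrightarrow> f (g [^] \<kappa>) = f g" and g: "g \<in> carrier G"
  shows "f g \<in> Q_field p"
proof -
  have inv: "f (g [^] galois_exponent u) = f g" if u: "u \<in> totatives n'" for u
  proof -
    let ?k = "galois_exponent u"
    let ?h = "\<lambda>g\<in>carrier G. f (g [^] ?k)"
    have cop: "coprime ?k n" using u by (intro coprime_galois_exponent) (simp add: in_totatives_iff)
    have "?h = f"
    proof (rule characters_determined_by_fixed_elements[OF odd \<kappa>_square])
      show "?h \<in> irreducible_characters G" by (rule galois_conjugate_character[OF f cop])
      show "?h (x [^] \<kappa>) = ?h x" if x: "x \<in> carrier G" for x
        using fixed[of "x [^] ?k"] x by (simp add: nat_pow_pow mult.commute)
      show "?h x = f x" if "x \<in> carrier G" "x [^] \<kappa> = x" for x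
        using that fixed_iff[OF odd] pow_galois_exponent_fixed[of x u] by simp
    qed (use f fixed in auto)
    then have "?h g = f g" by (rule fun_cong)
    then show ?thesis using g by simp
  qed
  obtain es where es: "\<And>k::nat. f (g [^] k) = (\<Sum>e\<leftarrow>es. e ^ k)" "\<And>e. e \<in> set es \<Longrightarrow> e ^ n = 1"
    using character_power_sum[OF f g] by blast
  have "(\<Sum>u\<in>totatives n'. f (g [^] galois_exponent u)) = of_nat (totient n') * f g"
    by (simp add: inv totient_def)
  moreover have "(\<Sum>u\<in>totatives n'. f (g [^] galois_exponent u)) =
      (\<Sum>e\<leftarrow>es. \<Sum>u\<in>totatives n'. e ^ galois_exponent u)"
    unfolding es(1) by (induction es) (simp_all add: sum.distrib)
  moreover have "(\<Sum>e\<leftarrow>es. \<Sum>u\<in>totatives n'. e ^ galois_exponent u) \<in> Q_field p"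
  proof (rule Q_field_sum_list)
    fix e assume "e \<in> set es"
    then have e: "e ^ n = 1" by (rule es(2))
    have "n dvd A * n'" using A(2) by (simp add: order cong_0_iff mult_dvd_mono)
    then have a: "(e ^ A) ^ n' = 1" using e by (metis dvdE power_mult power_one)
    have "n dvd B * p ^ c" using B(1) by (simp add: order cong_0_iff mult_dvd_mono mult.commute)
    then have b: "(e ^ B) ^ (p ^ c) = 1" using e by (metis dvdE power_mult power_one)
    have "e ^ galois_exponent u = e ^ B * (e ^ A) ^ u" for u
      unfolding galois_exponent_def power_add power_mult by (rule mult.commute)
    then have "(\<Sum>u\<in>totatives n'. e ^ galois_exponent u) = e ^ B * (\<Sum>u\<in>totatives n'. (e ^ A) ^ u)"
      by (simp add: sum_distrib_left)
    also have "\<dots> \<in> Q_field p"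
      by (intro Q_field_mult Q_field_root[OF b] Q_field_rat ramanujan_sum_rational[OF n'_pos a])
    finally show "(\<Sum>u\<in>totatives n'. e ^ galois_exponent u) \<in> Q_field p" .
  qed
  ultimately have "of_nat (totient n') * f g \<in> Q_field p" by simp
  then have "inverse (of_nat (totient n')) * (of_nat (totient n') * f g) \<in> Q_field p"
    by (rule Q_field_mult[OF Q_field_rat, rotated]) simp
  then show ?thesis using n'_pos by (simp add: mult.assoc[symmetric])
qed

lemma Q_field_valued_iff_fixed:
  assumes odd: "odd n" and f: "f \<in> irreducible_characters G"
  shows "(\<forall>g\<in>carrier G. f g \<in> Q_field p) \<longleftrightarrow> (\<forall>g\<in>carrier G. f (g [^] \<kappa>) = f g)"
proof
  assume vals: "\<forall>g\<in>carrier G. f g \<in> Q_field p"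
  have "[\<kappa> = 1] (mod p ^ c)" unfolding \<kappa>_def by (rule galois_exponent_cong(1))
  then show "\<forall>g\<in>carrier G. f (g [^] \<kappa>) = f g"
    using Q_field_values_fixed[OF f bspec[OF vals] coprime_\<kappa>] by simp
next
  assume "\<forall>g\<in>carrier G. f (g [^] \<kappa>) = f g"
  then show "\<forall>g\<in>carrier G. f g \<in> Q_field p"
    using fixed_values_Q_field[OF odd f] by simp
qed

lemma card_Q_field_valued:
  assumes odd: "odd n"
  shows "card {f \<in> irreducible_characters G. \<forall>g\<in>carrier G. f g \<in> Q_field p} =
    card {C \<in> conj_classes G. \<forall>x\<in>C. \<exists>a. ord x = p ^ a}"
proof -
  have CG: "C \<subseteq> carrier G" if "C \<in> conj_classes G" for C
    using that by (auto simp: conj_classes_def orbits_def orbit_def)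
  have "{f \<in> irreducible_characters G. \<forall>g\<in>carrier G. f g \<in> Q_field p} =
      {f \<in> irreducible_characters G. \<forall>g\<in>carrier G. f (g [^] \<kappa>) = f g}"
    by (rule Collect_cong) (use Q_field_valued_iff_fixed[OF odd] in auto)
  moreover have "{C \<in> conj_classes G. \<forall>x\<in>C. \<exists>a. ord x = p ^ a} =
      {C \<in> conj_classes G. \<forall>g\<in>C. g [^] \<kappa> = g}"
  proof (rule Collect_cong, rule conj_cong[OF refl])
    fix C assume "C \<in> conj_classes G"
    then have "(\<exists>a. ord x = p ^ a) \<longleftrightarrow> x [^] \<kappa> = x" if "x \<in> C" for x
      using CG[of C] that fixed_iff[OF odd, of x] p_power_order_iff[of x] by auto
    then show "(\<forall>x\<in>C. \<exists>a. ord x = p ^ a) \<longleftrightarrow> (\<forall>g\<in>C. g [^] \<kappa> = g)" by (rule ball_cong[OF refl])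
  qed
  moreover have "card {f \<in> irreducible_characters G. \<forall>g\<in>carrier G. f (g [^] \<kappa>) = f g} =
      card {C \<in> conj_classes G. \<forall>g\<in>C. g [^] \<kappa> = g}"
  proof (rule card_fixed_characters[OF coprime_\<kappa>])
    fix g t assume g: "g \<in> carrier G" and t: "t \<in> carrier G" and eq: "t \<otimes> g \<otimes> inv t = g [^] \<kappa>"
    show "g [^] \<kappa> = g"
      unfolding fixed_iff[OF odd g] by (rule conjugate_\<kappa>_power[OF odd g t eq])
  qed
  ultimately show ?thesis by simp
qed

text \<open>
  The hypothesis on the exponents \<open>k\<close> holds for characters with values in the field of another prime, whose exponents
  include those that are \<open>1\<close> modulo \<open>n'\<close>. The exponent \<open>l\<close> is \<open>1\<close> modulo \<open>n'\<close> and \<open>-1\<close> modulo \<open>p ^ c\<close>, so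
  that \<open>\<kappa> * l\<close> is \<open>-1\<close> modulo \<open>n\<close>: such a character is real.
\<close>

lemma Q_field_valued_complement_fixed_trivial:
  assumes odd: "odd n" and f: "f \<in> irreducible_characters G"
    and fp: "\<And>g. g \<in> carrier G \<Longrightarrow> f g \<in> Q_field p" 
    and fq: "\<And>k g. coprime k n \<Longrightarrow> [k = 1] (mod n') \<Longrightarrow> g \<in> carrier G \<Longrightarrow> f (g [^] k) = f g"
  shows "f = (\<lambda>g\<in>carrier G. 1)"
proof (rule real_character_trivial[OF odd f])
  fix g assume g: "g \<in> carrier G"
  define l where "l = A + B * (p ^ c - 1)"
  have pc: "p ^ c > 0" using p by (simp add: prime_gt_0_nat)
  have "[l = 1 + 0 * (p ^ c - 1)] (mod n')" unfolding l_def by (intro cong_add cong_mult A B cong_refl)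
  then have l1: "[l = 1] (mod n')" by simp
  have "[l = 0 + 1 * (p ^ c - 1)] (mod p ^ c)" unfolding l_def by (intro cong_add cong_mult A B cong_refl)
  then have l2: "[l = p ^ c - 1] (mod p ^ c)" by simp
  have "coprime (p ^ c - 1) (p ^ c)" using pc by (metis Suc_diff_1 coprime_Suc_left_nat coprime_commute)
  then have "coprime l (p ^ c)" using cong_imp_coprime[OF cong_sym[OF l2]] by simp
  moreover have "coprime l n'" using cong_imp_coprime[OF cong_sym[OF l1]] by simp
  ultimately have cop: "coprime l n" unfolding order by simp
  have "[\<kappa> * l + 1 = 0] (mod n)"
  proof (rule cong_order)
    have "[\<kappa> * l + 1 = 1 * (p ^ c - 1) + 1] (mod p ^ c)"
      unfolding \<kappa>_def by (intro cong_add cong_mult galois_exponent_cong l2 cong_refl)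
    then show "[\<kappa> * l + 1 = 0] (mod p ^ c)" using pc by (simp add: cong_def)
    have "[\<kappa> * l + 1 = (n' - 1) * 1 + 1] (mod n')"
      unfolding \<kappa>_def by (intro cong_add cong_mult galois_exponent_cong l1 cong_refl)
    then show "[\<kappa> * l + 1 = 0] (mod n')" using n'_pos by (simp add: cong_def)
  qed
  then have "g [^] (\<kappa> * l + 1) = g [^] (0::nat)" by (rule pow_cong_order[OF g])
  then have "g [^] (\<kappa> * l) \<otimes> g = \<one>" using g by simp
  then have "inv g = (g [^] \<kappa>) [^] l" using g by (simp add: nat_pow_pow inv_equality)
  then have "f (inv g) = f (g [^] \<kappa>)" using fq[OF cop l1, of "g [^] \<kappa>"] g by simp
  also have "\<dots> = f g" using Q_field_valued_iff_fixed[OF odd f] fp g by blast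
  finally show "f (inv g) = f g" .
qed

end

section \<open>Combining the primes\<close>

text \<open>
  The number depends only on the cardinalities of the sets; this is how the counts for the single primes
  are combined. The index set may be infinite, but disjoint non-empty parts of a finite set are finite
  in number.
\<close>

lemma card_UN_common_point:
  fixes A :: "'i \<Rightarrow> 'x set"
  assumes I: "I \<noteq> {}" and X: "finite X"
    and A: "\<And>i. i \<in> I \<Longrightarrow> A i \<subseteq> X" "\<And>i. i \<in> I \<Longrightarrow> a \<in> A i"
      "\<And>i j. i \<in> I \<Longrightarrow> j \<in> I \<Longrightarrow> i \<noteq> j \<Longrightarrow> A i \<inter> A j \<subseteq> {a}"
  shows "card (\<Union>i\<in>I. A i) = Suc (\<Sum>i | i \<in> I \<and> card (A i) > 1. card (A i) - 1)"
proof -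
  define J where "J = {i \<in> I. card (A i) > 1}"
  have finA: "finite (A i)" if "i \<in> I" for i using A(1)[OF that] X by (rule finite_subset)
  have ne: "A i - {a} \<noteq> {}" if "i \<in> J" for i
  proof
    assume "A i - {a} = {}"
    then have "card (A i) \<le> card {a}" by (intro card_mono) auto
    then show False using that by (simp add: J_def)
  qed
  have triv: "A i = {a}" if "i \<in> I" "i \<notin> J" for i
  proof -
    have "card {a} \<ge> card (A i)" using that by (simp add: J_def)
    then show ?thesis using card_seteq[OF finA[OF that(1)], of "{a}"] A(2)[OF that(1)] by simp
  qed
  define pick where "pick i = (SOME x. x \<in> A i - {a})" for i
  have pick: "pick i \<in> A i - {a}" if "i \<in> J" for i
    unfolding pick_def using ne[OF that] by (metis all_not_in_conv someI_ex)
  have "inj_on pick J"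
  proof (rule inj_onI, rule ccontr)
    fix i j assume ij: "i \<in> J" "j \<in> J" "pick i = pick j" "i \<noteq> j"
    then have "pick i \<in> A i \<inter> A j" using pick[of i] pick[of j] by auto
    then have "pick i = a" using A(3)[of i j] ij by (auto simp: J_def)
    then show False using pick[of i] ij by simp
  qed
  moreover have "pick ` J \<subseteq> X" using pick A(1) by (auto simp: J_def)
  ultimately have finJ: "finite J" using X inj_on_finite by blast
  have un: "(\<Union>i\<in>I. A i) = insert a (\<Union>i\<in>J. A i - {a})"
  proof (intro equalityI subsetI)
    fix x assume "x \<in> (\<Union>i\<in>I. A i)"
    then obtain i where i: "i \<in> I" "x \<in> A i" by blast
    show "x \<in> insert a (\<Union>i\<in>J. A i - {a})"
    proof (cases "i \<in> J")
      case True
      then show ?thesis using i by blast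
    next
      case False
      then show ?thesis using i triv[OF i(1)] by simp
    qed
  next
    fix x assume x: "x \<in> insert a (\<Union>i\<in>J. A i - {a})"
    obtain i where "i \<in> I" using I by blast
    then show "x \<in> (\<Union>i\<in>I. A i)" using x A(2)[of i] by (cases "x = a") (auto simp: J_def)
  qed
  have "finite (\<Union>i\<in>J. A i - {a})" using finJ finA by (auto simp: J_def)
  moreover have "a \<notin> (\<Union>i\<in>J. A i - {a})" by blast
  ultimately have "card (\<Union>i\<in>I. A i) = Suc (card (\<Union>i\<in>J. A i - {a}))"
    unfolding un by (rule card_insert_disjoint)
  also have "card (\<Union>i\<in>J. A i - {a}) = (\<Sum>i\<in>J. card (A i - {a}))"
  proof (rule card_UN_disjoint[OF finJ])
    show "\<forall>i\<in>J. finite (A i - {a})" using finA by (auto simp: J_def)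
    show "\<forall>i\<in>J. \<forall>j\<in>J. i \<noteq> j \<longrightarrow> (A i - {a}) \<inter> (A j - {a}) = {}"
      using A(3) by (auto simp: J_def)
  qed
  also have "\<dots> = (\<Sum>i\<in>J. card (A i) - 1)"
    by (rule sum.cong[OF refl]) (use A(2) in \<open>simp add: J_def card_Diff_singleton\<close>)
  finally show ?thesis by (simp add: J_def)
qed

context finite_group
begin

lemma prime_decomposition:
  assumes p: "Factorial_Ring.prime p"
  obtains c n' A B where "finite_group_prime G p c n' A B"
proof -
  have "\<not> is_unit p" using p by auto
  then obtain n' where n': "n = p ^ multiplicity p n * n'" "\<not> p dvd n'"
    using multiplicity_decompose'[of n p] order_pos by auto
  have cop: "coprime (p ^ multiplicity p n) n'" using p n'(2) by (simp add: prime_imp_coprime)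
  obtain A where A: "[A = 0] (mod p ^ multiplicity p n)" "[A = 1] (mod n')"
    using binary_chinese_remainder_nat[OF cop] by blast
  obtain B where B: "[B = 1] (mod p ^ multiplicity p n)" "[B = 0] (mod n')"
    using binary_chinese_remainder_nat[OF cop] by blast
  have "finite_group_prime G p (multiplicity p n) n' A B"
    by unfold_locales (use p n' A B in auto)
  then show thesis by (rule that)
qed

lemma conjugacy_classE:
  assumes "C \<in> conj_classes G"
  obtains x where "x \<in> carrier G" "x \<in> C" "C = {t \<otimes> x \<otimes> inv t |t. t \<in> carrier G}"
proof -
  obtain x where x: "x \<in> carrier G" "C = {t \<otimes> x \<otimes> inv t |t. t \<in> carrier G}"
    using assms by (auto simp: conj_classes_def orbits_def orbit_def)
  have "\<one> \<otimes> x \<otimes> inv \<one> \<in> C" unfolding x(2) by blast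
  then have "x \<in> C" using x(1) by simp
  with x show thesis using that by blast
qed

lemma trivial_class: "{t \<otimes> \<one> \<otimes> inv t |t. t \<in> carrier G} = {\<one>}"
  by (auto intro!: exI[of _ "\<one>"])

lemma trivial_class_mem: "{\<one>} \<in> conj_classes G"
proof -
  have "{\<one>} = orbit G (\<lambda>g. \<lambda>h\<in>carrier G. g \<otimes> h \<otimes> inv g) \<one>"
    unfolding orbit_def trivial_class[symmetric] by auto
  then show ?thesis unfolding conj_classes_def orbits_def by blast
qed

lemma card_prime_power_classes:
  assumes odd: "odd n"
  shows "card {C \<in> conj_classes G. \<forall>x\<in>C. prime_power_order G x} =
    card {\<chi> \<in> irreducible_characters G. Qpp_valued G \<chi>}"
proof -
  define I where "I = {p :: nat. Factorial_Ring.prime p}"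
  define K where "K p = {C \<in> conj_classes G. \<forall>x\<in>C. \<exists>a. ord x = p ^ a}" for p :: nat
  define X where "X p = {\<chi> \<in> irreducible_characters G. \<forall>g\<in>carrier G. \<chi> g \<in> Q_field p}" for p :: nat
  have CG: "C \<subseteq> carrier G" if "C \<in> conj_classes G" for C
    using that by (auto simp: conj_classes_def orbits_def orbit_def)
  have finC: "finite (conj_classes G)"
    by (rule finite_subset[of _ "Pow (carrier G)"]) (use CG fin in auto)
  have I: "I \<noteq> {}" using two_is_prime_nat by (auto simp: I_def)
  have K_eq: "{C \<in> conj_classes G. \<forall>x\<in>C. prime_power_order G x} = (\<Union>p\<in>I. K p)"
  proof (intro equalityI subsetI)
    fix C assume "C \<in> {C \<in> conj_classes G. \<forall>x\<in>C. prime_power_order G x}"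
    then have C: "C \<in> conj_classes G" and pp: "\<And>x. x \<in> C \<Longrightarrow> prime_power_order G x" by auto
    obtain x where x: "x \<in> carrier G" "x \<in> C" "C = {t \<otimes> x \<otimes> inv t |t. t \<in> carrier G}"
      using conjugacy_classE[OF C] by blast
    obtain p a where p: "Factorial_Ring.prime p" "ord x = p ^ a"
      using pp[OF x(2)] by (auto simp: prime_power_order_def)
    have "\<exists>b. ord y = p ^ b" if y: "y \<in> C" for y
    proof -
      obtain t where t: "t \<in> carrier G" "y = t \<otimes> x \<otimes> inv t" using y x(3) by blast
      have "y [^] (p ^ a) = \<one>"
        using t x(1) by (simp add: conjugate_pow p(2)[symmetric])
      moreover have "y \<in> carrier G" using t x(1) by simp
      ultimately have "ord y dvd p ^ a" using pow_eq_id by simp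
      then show ?thesis using divides_primepow_nat[OF p(1)] by auto
    qed
    then show "C \<in> (\<Union>p\<in>I. K p)" using C p(1) by (auto simp: I_def K_def)
  next
    fix C assume "C \<in> (\<Union>p\<in>I. K p)"
    then obtain p where "Factorial_Ring.prime p" "C \<in> conj_classes G" "\<forall>x\<in>C. \<exists>a. ord x = p ^ a"
      by (auto simp: I_def K_def)
    then show "C \<in> {C \<in> conj_classes G. \<forall>x\<in>C. prime_power_order G x}"
      unfolding prime_power_order_def by blast
  qed
  have X_eq: "{\<chi> \<in> irreducible_characters G. Qpp_valued G \<chi>} = (\<Union>p\<in>I. X p)"
    unfolding I_def X_def Qpp_valued_def by blast
  have card: "card (X p) = card (K p)" if "p \<in> I" for p
  proof -
    have p: "Factorial_Ring.prime p" using that by (simp add: I_def)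
    obtain c n' A B where P: "finite_group_prime G p c n' A B"
      by (rule prime_decomposition[OF p])
    interpret finite_group_prime G p c n' A B by (rule P)
    show ?thesis unfolding X_def K_def by (rule card_Q_field_valued[OF odd])
  qed
  have K_inter: "K p \<inter> K q \<subseteq> {{\<one>}}" if pq: "p \<in> I" "q \<in> I" "p \<noteq> q" for p q
  proof
    fix C assume "C \<in> K p \<inter> K q"
    then have C: "C \<in> conj_classes G" "\<And>x. x \<in> C \<Longrightarrow> \<exists>a. ord x = p ^ a" "\<And>x. x \<in> C \<Longrightarrow> \<exists>a. ord x = q ^ a"
      by (auto simp: K_def)
    obtain x where x: "x \<in> carrier G" "x \<in> C" "C = {t \<otimes> x \<otimes> inv t |t. t \<in> carrier G}"
      using conjugacy_classE[OF C(1)] by blast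
    obtain a b where ab: "ord x = p ^ a" "ord x = q ^ b" using C(2,3)[OF x(2)] by blast
    have "coprime (p ^ a) (q ^ b)" using pq by (simp add: I_def primes_coprime)
    then have "coprime (ord x) (ord x)" by (simp only: ab(1)[symmetric] ab(2)[symmetric])
    then have "ord x = 1" by simp
    then have "x = \<one>" using ord_eq_1[OF x(1)] by simp
    then show "C \<in> {{\<one>}}" using x(3) trivial_class by simp
  qed
  have X_inter: "X p \<inter> X q \<subseteq> {\<lambda>g\<in>carrier G. 1}" if pq: "p \<in> I" "q \<in> I" "p \<noteq> q" for p q
  proof
    fix f assume "f \<in> X p \<inter> X q"
    then have f: "f \<in> irreducible_characters G" and fp: "\<And>g. g \<in> carrier G \<Longrightarrow> f g \<in> Q_field p"
      and fq: "\<And>g. g \<in> carrier G \<Longrightarrow> f g \<in> Q_field q" by (auto simp: X_def)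
    have p: "Factorial_Ring.prime p" and q: "Factorial_Ring.prime q" using pq by (simp_all add: I_def)
    obtain c n' A B where P: "finite_group_prime G p c n' A B"
      by (rule prime_decomposition[OF p])
    obtain c' m A' B' where Q: "finite_group_prime G q c' m A' B'"
      by (rule prime_decomposition[OF q])
    interpret P: finite_group_prime G p c n' A B by (rule P)
    interpret Q: finite_group_prime G q c' m A' B' by (rule Q)
    have "q ^ c' dvd p ^ c * n'" unfolding P.order[symmetric] Q.order by simp
    moreover have "coprime (q ^ c') (p ^ c)" using pq by (simp add: I_def primes_coprime)
    ultimately have dvd: "q ^ c' dvd n'" by (simp add: coprime_dvd_mult_right_iff)
    have "f = (\<lambda>g\<in>carrier G. 1)"
    proof (rule P.Q_field_valued_complement_fixed_trivial[OF odd f fp])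
      fix k g assume "coprime k n" "[k = 1] (mod n')" "g \<in> carrier G"
      then show "f (g [^] k) = f g"
        using Q.Q_field_values_fixed[OF f fq] dvd cong_dvd_modulus_nat by blast
    qed
    then show "f \<in> {\<lambda>g\<in>carrier G. 1}" by simp
  qed
  have K_one: "{\<one>} \<in> K p" for p
    using trivial_class_mem by (auto simp: K_def intro: exI[of _ "0::nat"])
  have X_one: "(\<lambda>g\<in>carrier G. 1) \<in> X p" for p
    using trivial_character by (auto simp: X_def intro: Q_field_one)
  have "card (\<Union>p\<in>I. K p) = Suc (\<Sum>p | p \<in> I \<and> card (K p) > 1. card (K p) - 1)"
    by (rule card_UN_common_point[OF I finC _ K_one K_inter]) (auto simp: K_def)
  moreover have "card (\<Union>p\<in>I. X p) = Suc (\<Sum>p | p \<in> I \<and> card (X p) > 1. card (X p) - 1)"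
    by (rule card_UN_common_point[OF I finite_irreducible_characters _ X_one X_inter]) (auto simp: X_def)
  moreover have "(\<Sum>p | p \<in> I \<and> card (X p) > 1. card (X p) - 1) = (\<Sum>p | p \<in> I \<and> card (K p) > 1. card (K p) - 1)"
    by (rule sum.cong) (auto simp: card)
  ultimately show ?thesis unfolding K_eq X_eq by simp
qed

end

theorem theorem1p3:
  fixes G :: "('a, 'b) monoid_scheme"
  assumes "group G" and "finite (carrier G)" and "odd (Coset.order G)"
  shows "card {C \<in> conj_classes G. \<forall>x\<in>C. prime_power_order G x} =
         card {\<chi> \<in> irreducible_characters G. Qpp_valued G \<chi>}"
proof -
  interpret finite_group G
    using assms by (intro finite_group.intro finite_group_axioms.intro)
  show ?thesis by (rule card_prime_power_classes[OF assms(3)])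
qed

end
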